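(* Let $X=(X_1,\ldots,X_N)$ be a family of independent random variables with $X_k$ taking values in a set $\Lambda_k$, let $\Gamma\subseteq\prod_{j\in[N]}\Lambda_j$ be an event and let $f:\prod_{j\in[N]}\Lambda_j\to\mathbb{R}$ be a function. Assume that there are numbers $(c_k)_{k\in[N]}$ and $(d_k)_{k\in[N]}$ with $c_k\le d_k$ such that whenever $x,\tilde x\in\prod_{j\in[N]}\Lambda_j$ differ only in the $k$-th coordinate we have $$|f(x)-f(\tilde x)|\le\begin{cases}c_k&\text{if }x,\tilde x\in\Gamma,\\ d_k&\text{otherwise.}\end{cases}$$ Let $q_k>0$ be numbers with $\min_{\eta\in\Lambda_k}\mathbb{P}(X_k=\eta)\ge q_k$ for each $k\in[N]$. Then for any numbers $(\gamma_k)_{k\in[N]}$ with $\gamma_k\in(0,1]$ there is an event $\mathcal{B}=\mathcal{B}(\Gamma,(\gamma_k)_{k\in[N]})$ satisfying $$\mathbb{P}(\mathcal{B})\le\sum_{k\in[N]}\gamma_k^{-1}\cdot\mathbb{P}(X\notin\Gamma)\quad\text{and}\quad\neg\mathcal{B}\subseteq\Gamma,$$ such that, with $\mu=\mathbb{E}f(X)$, $e_k=2\gamma_k(d_k-c_k)q_k^{-1}$ and $C=\max_{k\in[N]}(c_k+e_k)$, the following hold for any $t\ge0$. (a) $$\mathbb{P}(f(X)\ge\mu+t\text{ and }\neg\mathcal{B})\le\exp\left(-\frac{t^2}{2\sum_{k\in[N]}(c_k+e_k)^2}\right).$$ (b) If $|\Lambda_k|=2$ for every $k\in[N]$, then the exponent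 in (a) may be multiplied by a factor of $4$. (c) If $\Lambda_k=\{0,1\}$ and $p_k=\mathbb{P}(X_k=1)$ for every $k\in[N]$, then $$\mathbb{P}(f(X)\ge\mu+t\text{ and }\neg\mathcal{B})\le\exp\left(-\frac{t^2}{2V+2Ct/3}\right),\qquad V=\sum_{k\in[N]}(1-p_k)p_k(c_k+e_k)^2 .$$ (d) In the situation of (c), the right-hand side may be improved to $e^{-\frac{V}{C^2}\phi(Ct/V)}$, where $\phi(x)=(1+x)\log(1+x)-x$ (whenever $V,C>0$, so that this expression is defined). (e) If $p_k\in[0,1)$ are numbers with $\max_{\eta\in\Lambda_k}\mathbb{P}(X_k=\eta)\ge1-p_k$ for every $k\in[N]$, then $$\mathbb{P}(f(X)\ge\mu+t\text{ and }\neg\mathcal{B})\le\exp\left(-\frac{t^2}{2\sum_{k\in[N]}p_k\left(c_k+e_k(1-p_k)^{-1}\right)^2+2Ct/3}\right).$$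
   Context: $[N]=\{1,\ldots,N\}$. Events $\mathcal{B},\Gamma$ are identified with subsets of $\prod_{j\in[N]}\Lambda_j$; $\mathbb{P}(\mathcal{B})=\mathbb{P}(X\in\mathcal{B})$ and $\neg\mathcal{B}$ is the complement. The notation $\mathcal{B}=\mathcal{B}(\Gamma,(\gamma_k)_{k\in[N]})$ means that $\mathcal{B}$ depends only on $\Gamma$ and $(\gamma_k)$ (and the law of $X$), not on $f$ or $t$. *)

theory Defs
  imports "HOL-Probability.Probability"
begin

text \<open>
  The sets \<open>\<Lambda> k\<close> live in a common type and points of the product are extensional functions on
  \<open>{1..N}\<close>. The sets \<open>\<Lambda> k\<close> carry the discrete sigma-algebra: as soon as all atoms of \<open>X k\<close> have
  probability at least \<open>q k > 0\<close>, \<open>\<Lambda> k\<close> is finite, so that every subset of the product is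
  an event and the infimum and supremum over \<open>\<Lambda> k\<close> of the atom probabilities are a minimum and a
  maximum. The two-point set \<open>{0, 1}\<close> appears as \<open>{zero, one}\<close> for distinct labels \<open>zero\<close> and \<open>one\<close>,
  the same for all coordinates, because the common type is arbitrary.
\<close>

definition outcome_space :: "nat \<Rightarrow> (nat \<Rightarrow> 'a set) \<Rightarrow> (nat \<Rightarrow> 'a) measure" where
  "outcome_space N \<Lambda> = PiM {1..N} (\<lambda>k. count_space (\<Lambda> k))"

definition rvec :: "nat \<Rightarrow> (nat \<Rightarrow> 'w \<Rightarrow> 'a) \<Rightarrow> 'w \<Rightarrow> nat \<Rightarrow> 'a" where
  "rvec N X \<omega> = (\<lambda>k\<in>{1..N}. X k \<omega>)"

definition differ_only_in :: "nat \<Rightarrow> nat \<Rightarrow> (nat \<Rightarrow> 'a) \<Rightarrow> (nat \<Rightarrow> 'a) \<Rightarrow> bool" where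
  "differ_only_in N k x y \<longleftrightarrow> x k \<noteq> y k \<and> (\<forall>j\<in>{1..N} - {k}. x j = y j)"

definition typical_bounded_differences ::
  "nat \<Rightarrow> (nat \<Rightarrow> 'a set) \<Rightarrow> (nat \<Rightarrow> 'a) set \<Rightarrow> ((nat \<Rightarrow> 'a) \<Rightarrow> real) \<Rightarrow>
    (nat \<Rightarrow> real) \<Rightarrow> (nat \<Rightarrow> real) \<Rightarrow> bool" where
  "typical_bounded_differences N \<Lambda> \<Gamma> f c d \<longleftrightarrow>
    (\<forall>k\<in>{1..N}. c k \<le> d k \<and>
      (\<forall>x\<in>PiE {1..N} \<Lambda>. \<forall>y\<in>PiE {1..N} \<Lambda>. differ_only_in N k x y \<longrightarrow>
        \<bar>f x - f y\<bar> \<le> (if x \<in> \<Gamma> \<and> y \<in> \<Gamma> then c k else d k)))"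

definition phi :: "real \<Rightarrow> real" where
  "phi x = (1 + x) * ln (1 + x) - x"

end

theory Submission
  imports Defs
begin

text \<open>
  Reveal the coordinates one at a time. The exceptional event collects the points outside \<open>\<Gamma>\<close>
  together with those for which, for some \<open>k\<close>, the probability of \<open>X \<notin> \<Gamma>\<close> given the first \<open>k - 1\<close>
  coordinates exceeds \<open>\<gamma> k\<close>; Markov's inequality bounds its probability. Away from it, conditioning
  on a further value of coordinate \<open>k\<close> makes \<open>X \<notin> \<Gamma>\<close> have probability at most \<open>\<gamma> k / q k\<close>. Coupling
  two values of coordinate \<open>k\<close> by keeping all later coordinates equal, \<open>f\<close> changes by at most \<open>c k\<close>
  unless one of the two points leaves \<open>\<Gamma>\<close>. So the values of the \<open>k\<close>-th martingale increment spread
  over a range of length at most \<open>c k + e k\<close>, and an exponential supermartingale killed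
  upon entering the exceptional event yields the Hoeffding and Bennett bounds.
\<close>

section \<open>Moment generating functions\<close>

lemma exp_minus_affine_series:
  "(\<lambda>n. inverse (fact (n + 2)) * u ^ (n + 2)) sums (exp u - 1 - (u::real))"
proof -
  have "summable (\<lambda>n. inverse (fact (n + 2)) * u ^ (n + 2))"
    using summable_ignore_initial_segment[OF summable_exp_generic[of u], of 2] by simp
  then show ?thesis
    using exp_first_two_terms[of u] by (simp add: sums_iff)
qed

lemma exp_minus_affine_ge:
  fixes u :: real
  assumes "0 \<le> u"
  shows "u\<^sup>2 / 2 \<le> exp u - 1 - u"
  using exp_lower_Taylor_quadratic[OF assms] by simp

lemma exp_minus_affine_le:
  fixes y :: real
  assumes "y \<le> 0"
  shows "exp y - 1 - y \<le> y\<^sup>2 / 2"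
proof -
  have "exp 0 - 1 - 0 - 0\<^sup>2 / 2 \<ge> exp y - 1 - y - y\<^sup>2 / 2"
  proof (rule DERIV_nonneg_imp_nondecreasing[OF assms])
    fix x :: real
    have "((\<lambda>x. exp x - 1 - x - x\<^sup>2 / 2) has_real_derivative exp x - 1 - x) (at x)"
      by (auto intro!: derivative_eq_intros)
    moreover have "0 \<le> exp x - 1 - x"
      using exp_ge_add_one_self[of x] by linarith
    ultimately show "\<exists>z. ((\<lambda>x. exp x - 1 - x - x\<^sup>2 / 2) has_real_derivative z) (at x) \<and> 0 \<le> z"
      by blast
  qed
  then show ?thesis by simp
qed

text \<open>Monotonicity of \<open>(exp y - 1 - y) / y\<^sup>2\<close>, cleared of denominators so
  that zero arguments need no separate treatment. For nonnegative \<open>y\<close> the power series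
  compare term by term; for negative \<open>y\<close> the quantity
  \<open>u\<^sup>2 * y\<^sup>2 / 2\<close> lies between the two sides.\<close>

lemma exp_minus_affine_scaling:
  fixes u y :: real
  assumes "y \<le> u" "0 \<le> u"
  shows "u\<^sup>2 * (exp y - 1 - y) \<le> y\<^sup>2 * (exp u - 1 - u)"
proof (cases "0 \<le> y")
  case True
  show ?thesis
  proof (rule sums_le)
    show "(\<lambda>n. u\<^sup>2 * (inverse (fact (n + 2)) * y ^ (n + 2))) sums (u\<^sup>2 * (exp y - 1 - y))"
      and "(\<lambda>n. y\<^sup>2 * (inverse (fact (n + 2)) * u ^ (n + 2))) sums (y\<^sup>2 * (exp u - 1 - u))"
      by (intro sums_mult exp_minus_affine_series)+
    fix n
    have "u\<^sup>2 * y\<^sup>2 * inverse (fact (n + 2)) * y ^ n \<le> u\<^sup>2 * y\<^sup>2 * inverse (fact (n + 2)) * u ^ n"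
      using True assms by (intro mult_left_mono power_mono) auto
    then show "u\<^sup>2 * (inverse (fact (n + 2)) * y ^ (n + 2)) \<le> y\<^sup>2 * (inverse (fact (n + 2)) * u ^ (n + 2))"
      by (simp add: power_add power2_eq_square mult_ac del: fact_Suc)
  qed
next
  case False
  then have "u\<^sup>2 * (exp y - 1 - y) \<le> u\<^sup>2 * (y\<^sup>2 / 2)"
    by (intro mult_left_mono exp_minus_affine_le) auto
  also have "\<dots> = y\<^sup>2 * (u\<^sup>2 / 2)" by simp
  also have "\<dots> \<le> y\<^sup>2 * (exp u - 1 - u)"
    using assms by (intro mult_left_mono exp_minus_affine_ge) auto
  finally show ?thesis .
qed

text \<open>This turns Bennett's exponent into Bernstein's. The difference of the two sides vanishes
  at 0, and so does its derivative \<open>D\<close>, which is nondecreasing because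
  \<open>(3 + z) ^ 3\<close> expands to 27 + 27 z plus nonnegative terms.\<close>

lemma phi_lower_bound:
  assumes "0 \<le> x"
  shows "x\<^sup>2 / (2 + 2 * x / 3) \<le> phi x"
proof -
  \<comment> \<open>The subtracted term is the derivative of
    \<open>x\<^sup>2 / (2 + 2 * x / 3)\<close>, rewritten as 3/2 times
    \<open>x\<^sup>2 / (3 + x)\<close>; the logarithm is the derivative of
    \<open>phi\<close>.\<close>
  define D where "D x = ln (1 + x) - 3 / 2 * (1 - 9 / (3 + x)\<^sup>2)" for x :: real
  have D: "0 \<le> D y" if "0 \<le> y" for y
  proof -
    have "D 0 \<le> D y"
    proof (rule DERIV_nonneg_imp_nondecreasing[OF that])
      fix z :: real assume z: "0 \<le> z"
      have "(D has_real_derivative 1 / (1 + z) - 27 / (3 + z) ^ 3) (at z)"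
        unfolding D_def
        by (insert z, (rule derivative_eq_intros refl | simp)+)
          (simp add: divide_simps power2_eq_square power3_eq_cube, algebra?)
      moreover have "27 / (3 + z) ^ 3 \<le> 1 / (1 + z)"
      proof -
        have "27 * (1 + z) \<le> (3 + z) ^ 3"
          using z by (simp add: power3_eq_cube algebra_simps)
        then show ?thesis using z by (simp add: divide_simps)
      qed
      ultimately show "\<exists>d. (D has_real_derivative d) (at z) \<and> 0 \<le> d" by auto
    qed
    then show ?thesis by (simp add: D_def)
  qed
  define E where "E x = phi x - x\<^sup>2 / (2 + 2 * x / 3)" for x :: real
  have "E 0 \<le> E x"
  proof (rule DERIV_nonneg_imp_nondecreasing[OF assms])
    fix z :: real assume z: "0 \<le> z"
    have "(E has_real_derivative D z) (at z)"
      unfolding E_def phi_def D_def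
      by (insert z, (rule derivative_eq_intros refl | simp)+)
        (simp add: divide_simps power2_eq_square, algebra?)
    with D[OF z] show "\<exists>d. (E has_real_derivative d) (at z) \<and> 0 \<le> d" by auto
  qed
  then show ?thesis by (simp add: E_def phi_def)
qed

section \<open>Moment generating functions of finite weighted sums\<close>

lemma sum_mult_diff_mean:
  fixes w h :: "'a \<Rightarrow> real"
  assumes "sum w A = 1"
  shows "(\<Sum>a\<in>A. w a * (h a - z)) = (\<Sum>a\<in>A. w a * h a) - z"
  using assms by (simp add: right_diff_distrib sum_subtractf flip: sum_distrib_right)

text \<open>Expanding around the mean kills the cross term and leaves the nonnegative square of the
  distance from \<open>z\<close> to the mean. It allows centring at a heavy atom instead of the
  mean.\<close>

lemma variance_le_second_moment:
  fixes w h :: "'a \<Rightarrow> real"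
  assumes "sum w A = 1"
  shows "(\<Sum>a\<in>A. w a * (h a - (\<Sum>b\<in>A. w b * h b))\<^sup>2) \<le> (\<Sum>a\<in>A. w a * (h a - z)\<^sup>2)"
proof -
  define m where "m = (\<Sum>b\<in>A. w b * h b)"
  have "(\<Sum>a\<in>A. w a * (h a - z)\<^sup>2) =
      (\<Sum>a\<in>A. w a * (h a - m)\<^sup>2 + 2 * (m - z) * (w a * (h a - m)) + w a * (m - z)\<^sup>2)"
    by (intro sum.cong refl) (simp add: power2_eq_square algebra_simps)
  also have "\<dots> = (\<Sum>a\<in>A. w a * (h a - m)\<^sup>2) + 2 * (m - z) * (\<Sum>a\<in>A. w a * (h a - m)) + (m - z)\<^sup>2"
    using assms by (simp add: sum.distrib flip: sum_distrib_left sum_distrib_right)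
  also have "(\<Sum>a\<in>A. w a * (h a - m)) = 0"
    unfolding sum_mult_diff_mean[OF assms] m_def by simp
  finally show ?thesis unfolding m_def by simp
qed

text \<open>Hoeffding's lemma for random variables, applied to the distribution on \<open>A\<close>
  with weights \<open>w\<close>.\<close>

lemma hoeffding_mgf_sum:
  fixes w h :: "'a \<Rightarrow> real"
  assumes A: "finite A" and w: "\<And>a. a \<in> A \<Longrightarrow> 0 \<le> w a" and w1: "sum w A = 1"
    and r: "\<And>a b. a \<in> A \<Longrightarrow> b \<in> A \<Longrightarrow> \<bar>h a - h b\<bar> \<le> r" and s: "0 < s"
  shows "(\<Sum>a\<in>A. w a * exp (s * (h a - (\<Sum>b\<in>A. w b * h b)))) \<le> exp (s\<^sup>2 * r\<^sup>2 / 8)"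
proof -
  define P where "P = embed_pmf (\<lambda>a. if a \<in> A then w a else 0)"
  have pmf_P: "pmf P a = (if a \<in> A then w a else 0)" for a
    unfolding P_def
  proof (rule pmf_embed_pmf)
    have "(\<integral>\<^sup>+x. ennreal (if x \<in> A then w x else 0) \<partial>count_space UNIV) = (\<integral>\<^sup>+x. ennreal (w x) \<partial>count_space A)"
      by (simp add: nn_integral_count_space_indicator) (auto intro!: nn_integral_cong simp: indicator_def)
    also have "\<dots> = 1"
      using A w w1 by (simp add: nn_integral_count_space_finite)
    finally show "(\<integral>\<^sup>+x. ennreal (if x \<in> A then w x else 0) \<partial>count_space UNIV) = 1" .
  qed (use w in auto)
  have supp: "set_pmf P \<subseteq> A"
    by (auto simp: set_pmf_iff pmf_P split: if_splits)
  have E: "measure_pmf.expectation P g = (\<Sum>a\<in>A. w a * g a)" for g :: "'a \<Rightarrow> real"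
    by (subst integral_measure_pmf_real[OF A]) (use supp in \<open>auto simp: pmf_P mult.commute intro!: sum.cong\<close>)
  have "A \<noteq> {}" using w1 by auto
  \<comment> \<open>Both endpoints are values of \<open>h\<close>, so the length of the interval is
    itself one of the differences bounded by \<open>r\<close>.\<close>
  define lo where "lo = Min (h ` A)"
  define hi where "hi = Max (h ` A)"
  have "lo \<in> h ` A" "hi \<in> h ` A"
    using A \<open>A \<noteq> {}\<close> unfolding lo_def hi_def by (auto intro: Min_in Max_in)
  then obtain x y where xy: "x \<in> A" "lo = h x" "y \<in> A" "hi = h y" by auto
  have "hi - lo \<le> r" using r[OF xy(3,1)] xy by simp
  moreover have "lo \<le> hi" using Max_ge[of "h ` A" "h x"] A xy(1,2) by (simp add: hi_def)
  ultimately have width: "0 \<le> hi - lo" "hi - lo \<le> r" by auto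
  have "AE x in measure_pmf P. h x \<in> {lo..hi}"
    using supp A by (auto simp: AE_measure_pmf_iff lo_def hi_def)
  then interpret interval_bounded_random_variable "measure_pmf P" h lo hi
    by unfold_locales auto
  have "(\<integral>\<^sup>+x. ennreal (exp (s * (h x - measure_pmf.expectation P h))) \<partial>measure_pmf P)
      \<le> ennreal (exp (s\<^sup>2 * (hi - lo)\<^sup>2 / 8))"
    by (rule Hoeffdings_lemma_nn_integral[OF s])
  also have "(\<integral>\<^sup>+x. ennreal (exp (s * (h x - measure_pmf.expectation P h))) \<partial>measure_pmf P)
      = ennreal (measure_pmf.expectation P (\<lambda>x. exp (s * (h x - measure_pmf.expectation P h))))"
    by (intro nn_integral_eq_integral integrable_measure_pmf_finite finite_subset[OF supp A]) auto
  finally have "(\<Sum>a\<in>A. w a * exp (s * (h a - (\<Sum>b\<in>A. w b * h b)))) \<le> exp (s\<^sup>2 * (hi - lo)\<^sup>2 / 8)"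
    by (simp add: E)
  also have "\<dots> \<le> exp (s\<^sup>2 * r\<^sup>2 / 8)"
    using width by (auto intro!: divide_right_mono mult_left_mono power_mono)
  finally show ?thesis .
qed

text \<open>A quadratic polynomial that touches the exponential at 0 and meets it again at the
  largest admissible value \<open>s * C\<close> dominates it below that value. In the mean its
  linear term vanishes and its quadratic term is controlled by the variance; a bound from above on
  the centred values suffices for this.\<close>

lemma bennett_mgf_sum:
  fixes w h :: "'a \<Rightarrow> real"
  assumes w: "\<And>a. a \<in> A \<Longrightarrow> 0 \<le> w a" and w1: "sum w A = 1" and "0 < s" "0 < C"
    and le: "\<And>a. a \<in> A \<Longrightarrow> h a - (\<Sum>b\<in>A. w b * h b) \<le> C"
    and var: "(\<Sum>a\<in>A. w a * (h a - (\<Sum>b\<in>A. w b * h b))\<^sup>2) \<le> v"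
  shows "(\<Sum>a\<in>A. w a * exp (s * (h a - (\<Sum>b\<in>A. w b * h b))))
    \<le> exp (v * ((exp (s * C) - 1 - s * C) / C\<^sup>2))"
proof -
  define Y where "Y a = h a - (\<Sum>b\<in>A. w b * h b)" for a
  define K where "K = (exp (s * C) - 1 - s * C) / C\<^sup>2"
  have K: "0 \<le> K"
    using exp_ge_add_one_self[of "s * C"] unfolding K_def by (intro divide_nonneg_nonneg; linarith?) auto
  have "exp (s * Y a) \<le> 1 + s * Y a + (Y a)\<^sup>2 * K" if "a \<in> A" for a
  proof -
    have "(s * C)\<^sup>2 * (exp (s * Y a) - 1 - s * Y a) \<le> (s * Y a)\<^sup>2 * (exp (s * C) - 1 - s * C)"
      using le[OF that] assms(3,4) by (intro exp_minus_affine_scaling) (auto simp: Y_def)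
    then have "s\<^sup>2 * (C\<^sup>2 * (exp (s * Y a) - 1 - s * Y a)) \<le> s\<^sup>2 * ((Y a)\<^sup>2 * (exp (s * C) - 1 - s * C))"
      by (simp add: power_mult_distrib mult.assoc)
    then have "C\<^sup>2 * (exp (s * Y a) - 1 - s * Y a) \<le> (Y a)\<^sup>2 * (exp (s * C) - 1 - s * C)"
      using assms(3) by simp
    then have "exp (s * Y a) - 1 - s * Y a \<le> (Y a)\<^sup>2 * K"
      using assms(4) by (simp add: K_def pos_le_divide_eq mult.commute)
    then show ?thesis by simp
  qed
  then have "(\<Sum>a\<in>A. w a * exp (s * Y a)) \<le> (\<Sum>a\<in>A. w a * (1 + s * Y a + (Y a)\<^sup>2 * K))"
    by (intro sum_mono mult_left_mono w)
  also have "\<dots> = 1 + s * (\<Sum>a\<in>A. w a * Y a) + (\<Sum>a\<in>A. w a * (Y a)\<^sup>2) * K"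
    using w1 by (simp add: distrib_left sum.distrib sum_distrib_left sum_distrib_right mult_ac)
  also have "(\<Sum>a\<in>A. w a * Y a) = 0"
    unfolding Y_def sum_mult_diff_mean[OF w1] by simp
  also have "1 + s * 0 + (\<Sum>a\<in>A. w a * (Y a)\<^sup>2) * K \<le> 1 + v * K"
    using var K by (simp add: Y_def mult_right_mono)
  also have "\<dots> \<le> exp (v * K)"
    by (rule exp_ge_add_one_self)
  finally show ?thesis by (simp add: Y_def K_def)
qed

section \<open>Martingale tail bounds on finite products\<close>

text \<open>A discrete model of the law of independent coordinates: conditional expectations become
  finite sums, defined at every point and not only almost everywhere.\<close>

locale weighted_product =
  fixes N :: nat and \<Lambda> :: "nat \<Rightarrow> 'a set" and w :: "nat \<Rightarrow> 'a \<Rightarrow> real"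
  assumes finite_factor: "k \<in> {1..N} \<Longrightarrow> finite (\<Lambda> k)"
    and weight_pos: "k \<in> {1..N} \<Longrightarrow> \<eta> \<in> \<Lambda> k \<Longrightarrow> 0 < w k \<eta>"
    and sum_weight: "k \<in> {1..N} \<Longrightarrow> sum (w k) (\<Lambda> k) = 1"
begin

section \<open>Expectation and conditional expectation on a finite product\<close>

abbreviation points :: "(nat \<Rightarrow> 'a) set" where
  "points \<equiv> PiE {1..N} \<Lambda>"

definition expect :: "((nat \<Rightarrow> 'a) \<Rightarrow> real) \<Rightarrow> real" where
  "expect F = (\<Sum>x\<in>points. (\<Prod>k\<in>{1..N}. w k (x k)) * F x)"

definition avg :: "nat \<Rightarrow> ((nat \<Rightarrow> 'a) \<Rightarrow> real) \<Rightarrow> (nat \<Rightarrow> 'a) \<Rightarrow> real" where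
  "avg k F x = (\<Sum>\<eta>\<in>\<Lambda> k. w k \<eta> * F (x(k := \<eta>)))"

text \<open>\<open>cond k F\<close> is the conditional expectation of \<open>F\<close> given the first \<open>k\<close> coordinates.\<close>

definition cond :: "nat \<Rightarrow> ((nat \<Rightarrow> 'a) \<Rightarrow> real) \<Rightarrow> (nat \<Rightarrow> 'a) \<Rightarrow> real" where
  "cond k F = foldr avg [Suc k..<Suc N] F"

lemma finite_points: "finite points"
  by (intro finite_PiE) (auto simp: finite_factor)

lemma weight_nonneg: "k \<in> {1..N} \<Longrightarrow> \<eta> \<in> \<Lambda> k \<Longrightarrow> 0 \<le> w k \<eta>"
  using weight_pos[of k \<eta>] by simp

lemma points_upd: "x \<in> points \<Longrightarrow> k \<in> {1..N} \<Longrightarrow> \<eta> \<in> \<Lambda> k \<Longrightarrow> x(k := \<eta>) \<in> points"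
  by (auto simp: PiE_iff extensional_def)

lemma cond_N: "cond N F = F"
  by (simp add: cond_def)

lemma cond_step: "k < N \<Longrightarrow> cond k F x = (\<Sum>\<eta>\<in>\<Lambda> (Suc k). w (Suc k) \<eta> * cond (Suc k) F (x(Suc k := \<eta>)))"
  unfolding cond_def by (subst upt_conv_Cons) (simp_all add: avg_def del: upt_Suc)

lemma cond_avg: "k < N \<Longrightarrow> cond k F = avg (Suc k) (cond (Suc k) F)"
  by (rule ext) (simp add: cond_step avg_def)

lemma cond_mono:
  assumes "k \<le> N" "x \<in> points" "\<And>y. y \<in> points \<Longrightarrow> F y \<le> G y"
  shows "cond k F x \<le> cond k G x"
  using assms(1,2)
proof (induction k arbitrary: x rule: inc_induct)
  case base
  then show ?case using assms(3) by (simp add: cond_N)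
next
  case (step k)
  have "cond (Suc k) F (x(Suc k := \<eta>)) \<le> cond (Suc k) G (x(Suc k := \<eta>))" if "\<eta> \<in> \<Lambda> (Suc k)" for \<eta>
    using step.hyps step.prems that by (intro step.IH points_upd) auto
  then show ?case
    using step.hyps by (auto simp: cond_step weight_nonneg intro!: sum_mono mult_left_mono)
qed

lemma cond_const: "k \<le> N \<Longrightarrow> cond k (\<lambda>_. a) x = a"
proof (induction k arbitrary: x rule: inc_induct)
  case (step k)
  then show ?case by (simp add: cond_step sum_weight flip: sum_distrib_right)
qed (simp add: cond_N)

lemma cond_nonneg:
  assumes "k \<le> N" "x \<in> points" "\<And>y. y \<in> points \<Longrightarrow> 0 \<le> F y"
  shows "0 \<le> cond k F x"
  using cond_mono[OF assms(1,2), of "\<lambda>_. 0" F] assms by (simp add: cond_const)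

text \<open>The coordinates after \<open>k\<close> are overwritten by the averages, so they cannot
  influence the value.\<close>

lemma cond_cong:
  assumes "k \<le> N" "x \<in> points" "y \<in> points" "\<And>i. i \<in> {1..k} \<Longrightarrow> x i = y i"
  shows "cond k F x = cond k F y"
  using assms
proof (induction k arbitrary: x y rule: inc_induct)
  case base
  then have "x = y" by (intro PiE_ext) auto
  then show ?case by simp
next
  case (step k)
  have "cond (Suc k) F (x(Suc k := \<eta>)) = cond (Suc k) F (y(Suc k := \<eta>))" if "\<eta> \<in> \<Lambda> (Suc k)" for \<eta>
    using step.hyps step.prems that by (intro step.IH points_upd) auto
  then show ?case using step.hyps by (simp add: cond_step)
qed

lemma expect_mono: "(\<And>x. x \<in> points \<Longrightarrow> F x \<le> G x) \<Longrightarrow> expect F \<le> expect G"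
  unfolding expect_def by (intro sum_mono mult_left_mono prod_nonneg) (auto simp: weight_nonneg PiE_iff)

lemma expect_add: "expect (\<lambda>x. F x + G x) = expect F + expect G"
  by (simp add: expect_def distrib_left sum.distrib)

lemma expect_mult: "expect (\<lambda>x. a * F x) = a * expect F"
  by (simp add: expect_def sum_distrib_left mult_ac)

lemma expect_sum: "expect (\<lambda>x. \<Sum>i\<in>I. F i x) = (\<Sum>i\<in>I. expect (F i))"
  unfolding expect_def sum_distrib_left by (rule sum.swap)

lemma expect_const: "expect (\<lambda>_. a) = a"
proof -
  have "(\<Sum>x\<in>points. \<Prod>k\<in>{1..N}. w k (x k)) = 1"
    by (subst prod_sum_PiE[symmetric]) (auto simp: finite_factor sum_weight)
  then show ?thesis by (simp add: expect_def flip: sum_distrib_right)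
qed

lemma expect_avg:
  assumes k: "k \<in> {1..N}"
  shows "expect (avg k F) = expect F"
proof -
  define J where "J = {1..N} - {k}"
  have J: "{1..N} = insert k J" "k \<notin> J" "finite J"
    using k by (auto simp: J_def)
  \<comment> \<open>Fubini for the coordinate \<open>k\<close>: a point of the product is a point on
    \<open>J\<close> together with a value at \<open>k\<close>.\<close>
  have split: "expect G = (\<Sum>y\<in>PiE J \<Lambda>. (\<Prod>j\<in>J. w j (y j)) * (\<Sum>a\<in>\<Lambda> k. w k a * G (y(k := a))))" for G
  proof -
    have "inj_on (\<lambda>(a, y). y(k := a)) (\<Lambda> k \<times> PiE J \<Lambda>)"
      using J by (intro inj_combinator)
    then have "expect G = (\<Sum>(a, y)\<in>\<Lambda> k \<times> PiE J \<Lambda>. (\<Prod>j\<in>insert k J. w j ((y(k := a)) j)) * G (y(k := a)))"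
      unfolding expect_def J(1) PiE_insert_eq by (subst sum.reindex) (simp_all add: case_prod_unfold o_def)
    also have "\<dots> = (\<Sum>a\<in>\<Lambda> k. \<Sum>y\<in>PiE J \<Lambda>. (\<Prod>j\<in>J. w j (y j)) * (w k a * G (y(k := a))))"
      unfolding sum.cartesian_product
    proof (intro sum.cong refl, clarify)
      fix a y
      have "(\<Prod>j\<in>J. w j ((y(k := a)) j)) = (\<Prod>j\<in>J. w j (y j))"
        using J by (intro prod.cong) auto
      then show "(\<Prod>j\<in>insert k J. w j ((y(k := a)) j)) * G (y(k := a)) = (\<Prod>j\<in>J. w j (y j)) * (w k a * G (y(k := a)))"
        using J by simp
    qed
    also have "\<dots> = (\<Sum>y\<in>PiE J \<Lambda>. (\<Prod>j\<in>J. w j (y j)) * (\<Sum>a\<in>\<Lambda> k. w k a * G (y(k := a))))"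
      by (subst sum.swap) (simp add: sum_distrib_left)
    finally show ?thesis .
  qed
  \<comment> \<open>Averaging a second time over the same coordinate changes nothing, because the
    weights add up to 1.\<close>
  have "(\<Sum>a\<in>\<Lambda> k. w k a * avg k F (y(k := a))) = (\<Sum>a\<in>\<Lambda> k. w k a * F (y(k := a)))" for y
    using sum_weight[OF k] by (simp add: avg_def flip: sum_distrib_right)
  then show ?thesis by (simp add: split)
qed

lemma expect_cond: "k \<le> N \<Longrightarrow> expect (cond k F) = expect F"
proof (induction k rule: inc_induct)
  case (step k)
  then show ?case by (simp add: cond_avg expect_avg)
qed (simp add: cond_N)

text \<open>By \<open>cond_cong\<close> the function \<open>cond 0 F\<close> is constant on
  \<open>points\<close>, hence equal to its own expectation.\<close>

lemma cond_0:
  assumes "x \<in> points"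
  shows "cond 0 F x = expect F"
proof -
  have "expect F = expect (cond 0 F)" by (simp add: expect_cond)
  also have "\<dots> = expect (\<lambda>_. cond 0 F x)"
    unfolding expect_def by (intro sum.cong refl arg_cong2[of _ _ _ _ "(*)"] cond_cong) (use assms in auto)
  finally show ?thesis by (simp add: expect_const)
qed

lemma points_nonempty: "points \<noteq> {}"
  using expect_const[of 1] by (auto simp: expect_def)

text \<open>
  The indicator of \<open>G\<close> up to time \<open>k\<close> only involves the coordinates before the averaged one,
  so multiplying by it keeps the exponential supermartingale one.
\<close>

lemma exp_supermartingale_tail:
  assumes s: "0 \<le> s"
    and G: "\<And>k x y. k < N \<Longrightarrow> x \<in> points \<Longrightarrow> y \<in> points \<Longrightarrow> (\<And>i. i \<in> {1..k} \<Longrightarrow> x i = y i) \<Longrightarrow> G k x \<longleftrightarrow> G k y"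
    and mgf: "\<And>k x. k < N \<Longrightarrow> x \<in> points \<Longrightarrow> G k x \<Longrightarrow>
      (\<Sum>\<eta>\<in>\<Lambda> (Suc k). w (Suc k) \<eta> * exp (s * (cond (Suc k) f (x(Suc k := \<eta>)) - cond k f x))) \<le> exp (L (Suc k))"
  shows "expect (\<lambda>x. of_bool (expect f + t \<le> f x \<and> (\<forall>k<N. G k x))) \<le> exp ((\<Sum>k=1..N. L k) - s * t)"
proof -
  define H where "H x = of_bool (\<forall>k<N. G k x) * exp (s * f x)" for x
  \<comment> \<open>Backward induction over time. Passing from \<open>Suc k\<close> to
    \<open>k\<close> spends the indicator of \<open>G k\<close> on the moment bound for coordinate
    \<open>Suc k\<close>, which is why only the times below \<open>k\<close> survive on the
    right.\<close>
  have H: "cond k H x \<le> of_bool (\<forall>j<k. G j x) * exp (s * cond k f x + (\<Sum>i\<in>{Suc k..N}. L i))"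
    if "k \<le> N" "x \<in> points" for k x
    using that
  proof (induction k arbitrary: x rule: inc_induct)
    case base
    then show ?case by (simp add: cond_N H_def)
  next
    case (step k)
    define S where "S = (\<Sum>i\<in>{Suc (Suc k)..N}. L i)"
    have k: "Suc k \<in> {1..N}" using step.hyps by auto
    have upd: "x(Suc k := \<eta>) \<in> points" if "\<eta> \<in> \<Lambda> (Suc k)" for \<eta>
      using step.prems k that by (rule points_upd)
    \<comment> \<open>For times up to \<open>k\<close> the predicate \<open>G\<close> sees only
      coordinates up to \<open>k\<close>, so the indicator can be pulled out of the average over
      coordinate \<open>Suc k\<close>.\<close>
    have Gupd: "(\<forall>j<Suc k. G j (x(Suc k := \<eta>))) \<longleftrightarrow> (\<forall>j<Suc k. G j x)" if "\<eta> \<in> \<Lambda> (Suc k)" for \<eta>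
    proof -
      have "G j (x(Suc k := \<eta>)) \<longleftrightarrow> G j x" if "j < Suc k" for j
        using that step.hyps upd[OF \<open>\<eta> \<in> \<Lambda> (Suc k)\<close>] step.prems by (intro G) auto
      then show ?thesis by blast
    qed
    have "cond k H x \<le> (\<Sum>\<eta>\<in>\<Lambda> (Suc k). w (Suc k) \<eta> *
        (of_bool (\<forall>j<Suc k. G j x) * exp (s * cond (Suc k) f (x(Suc k := \<eta>)) + S)))"
      unfolding cond_step[OF \<open>k < N\<close>]
    proof (intro sum_mono mult_left_mono weight_nonneg k)
      fix \<eta> assume \<eta>: "\<eta> \<in> \<Lambda> (Suc k)"
      show "cond (Suc k) H (x(Suc k := \<eta>)) \<le> of_bool (\<forall>j<Suc k. G j x) * exp (s * cond (Suc k) f (x(Suc k := \<eta>)) + S)"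
        using step.IH[OF upd[OF \<eta>]] unfolding Gupd[OF \<eta>] S_def .
    qed
    also have "\<dots> = of_bool (\<forall>j<Suc k. G j x) * exp (s * cond k f x + S) *
        (\<Sum>\<eta>\<in>\<Lambda> (Suc k). w (Suc k) \<eta> * exp (s * (cond (Suc k) f (x(Suc k := \<eta>)) - cond k f x)))"
      by (auto simp: sum_distrib_left right_diff_distrib exp_diff exp_add intro!: sum.cong)
    also have "\<dots> \<le> of_bool (\<forall>j<k. G j x) * exp (s * cond k f x + S) * exp (L (Suc k))"
    \<comment> \<open>Once some \<open>G j\<close> has failed, the left side is zero; otherwise
      \<open>G k x\<close> holds and the moment bound is available.\<close>
    proof (cases "\<forall>j<Suc k. G j x")
      case True
      then show ?thesis using mgf[of k x] step.hyps step.prems by (auto intro!: mult_left_mono)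
    qed auto
    also have "\<dots> = of_bool (\<forall>j<k. G j x) * exp (s * cond k f x + (\<Sum>i\<in>{Suc k..N}. L i))"
      using step.hyps by (subst sum.atLeast_Suc_atMost[of "Suc k"]) (auto simp: S_def exp_add mult_ac)
    finally show ?case .
  qed
  obtain x0 where x0: "x0 \<in> points" using points_nonempty by blast
  \<comment> \<open>Chernoff's argument: on the event in question the exponential is at least
    1.\<close>
  have "expect (\<lambda>x. of_bool (expect f + t \<le> f x \<and> (\<forall>k<N. G k x)))
      \<le> expect (\<lambda>x. exp (- (s * (expect f + t))) * H x)"
  proof (rule expect_mono)
    fix x
    show "of_bool (expect f + t \<le> f x \<and> (\<forall>k<N. G k x)) \<le> exp (- (s * (expect f + t))) * H x"
    proof (cases "expect f + t \<le> f x \<and> (\<forall>k<N. G k x)")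
      case True
      then have "0 \<le> s * (f x - (expect f + t))" using s by simp
      then have "1 \<le> exp (- (s * (expect f + t)) + s * f x)"
        by (simp add: right_diff_distrib)
      then show ?thesis using True by (simp only: H_def exp_add) simp
    next
      case False
      show ?thesis by (simp only: False) (simp add: H_def)
    qed
  qed
  also have "\<dots> = exp (- (s * (expect f + t))) * cond 0 H x0"
    by (simp add: expect_mult cond_0[OF x0])
  also have "\<dots> \<le> exp (- (s * (expect f + t))) * exp (s * cond 0 f x0 + (\<Sum>i=1..N. L i))"
    using H[OF _ x0, of 0] by simp
  also have "\<dots> = exp ((\<Sum>k=1..N. L k) - s * t)"
    by (simp add: cond_0[OF x0] algebra_simps flip: exp_add)
  finally show ?thesis .
qed

section \<open>Tail bounds from the spread of the increments\<close>

definition spread_bounded ::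
  "(nat \<Rightarrow> (nat \<Rightarrow> 'a) \<Rightarrow> bool) \<Rightarrow> ((nat \<Rightarrow> 'a) \<Rightarrow> real) \<Rightarrow> (nat \<Rightarrow> real) \<Rightarrow> bool" where
  "spread_bounded G f r \<longleftrightarrow>
    (\<forall>k<N. \<forall>x\<in>points. \<forall>y\<in>points. (\<forall>i\<in>{1..k}. x i = y i) \<longrightarrow> G k x = G k y) \<and>
    (\<forall>k<N. \<forall>x\<in>points. G k x \<longrightarrow> (\<forall>\<eta>\<in>\<Lambda> (Suc k). \<forall>\<eta>'\<in>\<Lambda> (Suc k). \<eta> \<noteq> \<eta>' \<longrightarrow>
      \<bar>cond (Suc k) f (x(Suc k := \<eta>)) - cond (Suc k) f (x(Suc k := \<eta>'))\<bar> \<le> r (Suc k)))"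

abbreviation tail :: "(nat \<Rightarrow> (nat \<Rightarrow> 'a) \<Rightarrow> bool) \<Rightarrow> ((nat \<Rightarrow> 'a) \<Rightarrow> real) \<Rightarrow> real \<Rightarrow> real" where
  "tail G f t \<equiv> expect (\<lambda>x. of_bool (expect f + t \<le> f x \<and> (\<forall>k<N. G k x)))"

lemma tail_le_1: "tail G f t \<le> 1"
  using expect_mono[of "\<lambda>x. of_bool (expect f + t \<le> f x \<and> (\<forall>k<N. G k x))" "\<lambda>_. 1"]
  by (simp add: expect_const)

text \<open>Reduces the moment bound to a function \<open>h\<close> of a single coordinate: by
  \<open>cond_step\<close> the weighted mean of \<open>h\<close> is \<open>cond k f x\<close>, so
  the centred values of \<open>h\<close> are the martingale increments. Only distinct values are
  compared, as \<open>r\<close> may be negative at a coordinate with a single value.\<close>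

lemma spread_bounded_tail:
  assumes sb: "spread_bounded G f r" and s: "0 \<le> s"
    and mgf: "\<And>k x h. k < N \<Longrightarrow> x \<in> points \<Longrightarrow> G k x \<Longrightarrow>
      h = (\<lambda>\<eta>. cond (Suc k) f (x(Suc k := \<eta>))) \<Longrightarrow>
      (\<And>\<eta> \<eta>'. \<eta> \<in> \<Lambda> (Suc k) \<Longrightarrow> \<eta>' \<in> \<Lambda> (Suc k) \<Longrightarrow> \<eta> \<noteq> \<eta>' \<Longrightarrow> \<bar>h \<eta> - h \<eta>'\<bar> \<le> r (Suc k)) \<Longrightarrow>
      (\<Sum>\<eta>\<in>\<Lambda> (Suc k). w (Suc k) \<eta> * exp (s * (h \<eta> - (\<Sum>\<zeta>\<in>\<Lambda> (Suc k). w (Suc k) \<zeta> * h \<zeta>)))) \<le> exp (L (Suc k))"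
  shows "tail G f t \<le> exp ((\<Sum>k=1..N. L k) - s * t)"
proof (rule exp_supermartingale_tail[OF s])
  show "G k x \<longleftrightarrow> G k y" if "k < N" "x \<in> points" "y \<in> points" "\<And>i. i \<in> {1..k} \<Longrightarrow> x i = y i" for k x y
    using sb that unfolding spread_bounded_def by blast
  fix k x assume k: "k < N" "x \<in> points" "G k x"
  show "(\<Sum>\<eta>\<in>\<Lambda> (Suc k). w (Suc k) \<eta> * exp (s * (cond (Suc k) f (x(Suc k := \<eta>)) - cond k f x))) \<le> exp (L (Suc k))"
    unfolding cond_step[OF k(1)]
    by (rule mgf[OF k refl]) (use sb k in \<open>unfold spread_bounded_def, blast\<close>)
qed

lemma hoeffding_tail:
  assumes sb: "spread_bounded G f r" and t: "0 \<le> t"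
  shows "tail G f t \<le> exp (4 * - (t\<^sup>2 / (2 * (\<Sum>k=1..N. (r k)\<^sup>2))))"
\<comment> \<open>In both degenerate cases the exponent is 0, the second by division by zero, and
  the trivial bound 1 suffices.\<close>
proof (cases "t = 0 \<or> (\<Sum>k=1..N. (r k)\<^sup>2) = 0")
  case True
  then show ?thesis using tail_le_1[of f t G] by auto
next
  case False
  define S where "S = (\<Sum>k=1..N. (r k)\<^sup>2)"
  \<comment> \<open>The minimiser of \<open>s\<^sup>2 * S / 8 - s * t\<close>, with minimum -2
    \<open>t\<^sup>2 / S\<close>.\<close>
  define s where "s = 4 * t / S"
  have S: "0 < S" using False sum_nonneg[of "{1..N}" "\<lambda>k. (r k)\<^sup>2"] by (simp add: S_def)
  have s: "0 < s" using False S t by (simp add: s_def)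
  have "tail G f t \<le> exp ((\<Sum>k=1..N. s\<^sup>2 * (r k)\<^sup>2 / 8) - s * t)"
  proof (rule spread_bounded_tail[OF sb])
    fix k x h assume k: "k < N" and h: "\<And>\<eta> \<eta>'. \<eta> \<in> \<Lambda> (Suc k) \<Longrightarrow> \<eta>' \<in> \<Lambda> (Suc k) \<Longrightarrow> \<eta> \<noteq> \<eta>' \<Longrightarrow> \<bar>h \<eta> - h \<eta>'\<bar> \<le> r (Suc k)"
    \<comment> \<open>Equal arguments need a nonnegative bound; squaring removes the absolute value
      again.\<close>
    have "\<bar>h \<eta> - h \<eta>'\<bar> \<le> \<bar>r (Suc k)\<bar>" if "\<eta> \<in> \<Lambda> (Suc k)" "\<eta>' \<in> \<Lambda> (Suc k)" for \<eta> \<eta>'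
      using h[OF that] by (cases "\<eta> = \<eta>'") auto
    then have "(\<Sum>\<eta>\<in>\<Lambda> (Suc k). w (Suc k) \<eta> * exp (s * (h \<eta> - (\<Sum>\<zeta>\<in>\<Lambda> (Suc k). w (Suc k) \<zeta> * h \<zeta>))))
        \<le> exp (s\<^sup>2 * \<bar>r (Suc k)\<bar>\<^sup>2 / 8)"
      using k s by (intro hoeffding_mgf_sum) (auto simp: finite_factor weight_nonneg sum_weight)
    then show "(\<Sum>\<eta>\<in>\<Lambda> (Suc k). w (Suc k) \<eta> * exp (s * (h \<eta> - (\<Sum>\<zeta>\<in>\<Lambda> (Suc k). w (Suc k) \<zeta> * h \<zeta>))))
        \<le> exp (s\<^sup>2 * (r (Suc k))\<^sup>2 / 8)" by simp
  qed (use s in simp)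
  also have "(\<Sum>k=1..N. s\<^sup>2 * (r k)\<^sup>2 / 8) - s * t = s\<^sup>2 * S / 8 - s * t"
    by (simp add: S_def sum_distrib_left sum_divide_distrib)
  also have "\<dots> = 4 * - (t\<^sup>2 / (2 * S))"
    using S by (simp add: s_def field_simps power2_eq_square)
  finally show ?thesis by (simp add: S_def)
qed

text \<open>The deviation from the mean is the weighted average of the differences
  \<open>h \<eta> - h \<zeta>\<close>.\<close>

lemma diff_mean_le:
  assumes k: "k \<in> {1..N}" and h: "\<And>\<eta> \<eta>'. \<eta> \<in> \<Lambda> k \<Longrightarrow> \<eta>' \<in> \<Lambda> k \<Longrightarrow> \<eta> \<noteq> \<eta>' \<Longrightarrow> \<bar>h \<eta> - h \<eta>'\<bar> \<le> C"
    and C: "0 \<le> C" and \<eta>: "\<eta> \<in> \<Lambda> k"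
  shows "h \<eta> - (\<Sum>\<zeta>\<in>\<Lambda> k. w k \<zeta> * h \<zeta>) \<le> C"
proof -
  have "h \<eta> - (\<Sum>\<zeta>\<in>\<Lambda> k. w k \<zeta> * h \<zeta>) = (\<Sum>\<zeta>\<in>\<Lambda> k. w k \<zeta> * (h \<eta> - h \<zeta>))"
    using sum_weight[OF k] by (simp add: right_diff_distrib sum_subtractf flip: sum_distrib_right)
  also have "\<dots> \<le> (\<Sum>\<zeta>\<in>\<Lambda> k. w k \<zeta> * C)"
  proof (intro sum_mono mult_left_mono weight_nonneg k)
    fix \<zeta> assume "\<zeta> \<in> \<Lambda> k"
    then show "h \<eta> - h \<zeta> \<le> C" using h[OF \<eta>, of \<zeta>] C by (cases "\<eta> = \<zeta>") auto
  qed
  also have "\<dots> = C" using sum_weight[OF k] by (simp flip: sum_distrib_right)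
  finally show ?thesis .
qed

text \<open>Quantifying over all \<open>h\<close> makes this a property of the weights alone,
  applicable to every conditional increment at once.\<close>

definition variance_bounded ::
  "(nat \<Rightarrow> real) \<Rightarrow> (nat \<Rightarrow> real) \<Rightarrow> bool" where
  "variance_bounded r v \<longleftrightarrow> (\<forall>k\<in>{1..N}. \<forall>h.
    (\<forall>\<eta>\<in>\<Lambda> k. \<forall>\<eta>'\<in>\<Lambda> k. \<eta> \<noteq> \<eta>' \<longrightarrow> \<bar>h \<eta> - h \<eta>'\<bar> \<le> r k) \<longrightarrow>
    (\<Sum>\<eta>\<in>\<Lambda> k. w k \<eta> * (h \<eta> - (\<Sum>\<zeta>\<in>\<Lambda> k. w k \<zeta> * h \<zeta>))\<^sup>2) \<le> v k)"

lemma bennett_exp_tail: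
  assumes sb: "spread_bounded G f r" and vb: "variance_bounded r v"
    and C: "\<And>k. k \<in> {1..N} \<Longrightarrow> r k \<le> C" "0 < C" and s: "0 < s"
  shows "tail G f t \<le> exp ((\<Sum>k=1..N. v k) * ((exp (s * C) - 1 - s * C) / C\<^sup>2) - s * t)"
proof -
  have "tail G f t \<le> exp ((\<Sum>k=1..N. v k * ((exp (s * C) - 1 - s * C) / C\<^sup>2)) - s * t)"
  proof (rule spread_bounded_tail[OF sb])
    fix k x h assume k: "k < N" and h: "\<And>\<eta> \<eta>'. \<eta> \<in> \<Lambda> (Suc k) \<Longrightarrow> \<eta>' \<in> \<Lambda> (Suc k) \<Longrightarrow> \<eta> \<noteq> \<eta>' \<Longrightarrow> \<bar>h \<eta> - h \<eta>'\<bar> \<le> r (Suc k)"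
    have k': "Suc k \<in> {1..N}" using k by simp
    have hC: "\<bar>h \<eta> - h \<eta>'\<bar> \<le> C" if "\<eta> \<in> \<Lambda> (Suc k)" "\<eta>' \<in> \<Lambda> (Suc k)" "\<eta> \<noteq> \<eta>'" for \<eta> \<eta>'
      using h[OF that] C(1)[OF k'] by simp
    show "(\<Sum>\<eta>\<in>\<Lambda> (Suc k). w (Suc k) \<eta> * exp (s * (h \<eta> - (\<Sum>\<zeta>\<in>\<Lambda> (Suc k). w (Suc k) \<zeta> * h \<zeta>))))
        \<le> exp (v (Suc k) * ((exp (s * C) - 1 - s * C) / C\<^sup>2))"
      using k' C s vb h unfolding variance_bounded_def
      by (intro bennett_mgf_sum diff_mean_le[OF k' hC]) (auto simp: weight_nonneg sum_weight)
  qed (use s in simp)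
  then show ?thesis by (simp only: sum_distrib_right)
qed

lemma bennett_tail:
  assumes sb: "spread_bounded G f r" and vb: "variance_bounded r v"
    and C: "\<And>k. k \<in> {1..N} \<Longrightarrow> r k \<le> C" "0 < C" and V: "(\<Sum>k=1..N. v k) \<le> V" "0 < V" and t: "0 \<le> t"
  shows "tail G f t \<le> exp (- (V / C\<^sup>2 * phi (C * t / V)))"
proof (cases "t = 0")
  case True
  then show ?thesis using tail_le_1[of f t G] by (simp add: phi_def)
next
  case False
  \<comment> \<open>The stationary point of \<open>V * K - s * t\<close> as a function of
    \<open>s\<close>, where \<open>exp (s * C)\<close> equals \<open>1 + C * t / V\<close>.\<close>
  define s where "s = ln (1 + C * t / V) / C"
  define K where "K = (exp (s * C) - 1 - s * C) / C\<^sup>2"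
  have x: "0 < C * t / V" using False t C V by simp
  then have s: "0 < s" using C by (simp add: s_def)
  have K: "0 \<le> K" unfolding K_def
    using exp_ge_add_one_self[of "s * C"] by (intro divide_nonneg_nonneg; linarith?) auto
  have "tail G f t \<le> exp ((\<Sum>k=1..N. v k) * K - s * t)"
    unfolding K_def by (rule bennett_exp_tail[OF sb vb C s])
  also have "\<dots> \<le> exp (V * K - s * t)"
    using mult_right_mono[OF V(1) K] by simp
  also have "V * K - s * t = - (V / C\<^sup>2 * phi (C * t / V))"
  proof -
    have "exp (s * C) = 1 + C * t / V" using x C by (simp add: s_def)
    moreover have "s * C = ln (1 + C * t / V)" using C by (simp add: s_def)
    ultimately show ?thesis
      using C V by (simp add: K_def phi_def s_def field_simps power2_eq_square)
  qed
  finally show ?thesis .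
qed

text \<open>While \<open>G\<close> holds, the conditional expectation of \<open>f\<close> does not
  move, so each moment factor is at most 1 and any rate \<open>s\<close> is available. This covers
  \<open>C \<le> 0\<close> in Bernstein's bound.\<close>

lemma constant_tail:
  assumes sb: "spread_bounded G f r" and r: "\<And>k. k \<in> {1..N} \<Longrightarrow> r k \<le> 0" and s: "0 \<le> s"
  shows "tail G f t \<le> exp (- (s * t))"
proof -
  have "tail G f t \<le> exp ((\<Sum>k=1..N. 0) - s * t)"
  proof (rule spread_bounded_tail[OF sb s])
    fix k x h assume k: "k < N" and h: "\<And>\<eta> \<eta>'. \<eta> \<in> \<Lambda> (Suc k) \<Longrightarrow> \<eta>' \<in> \<Lambda> (Suc k) \<Longrightarrow> \<eta> \<noteq> \<eta>' \<Longrightarrow> \<bar>h \<eta> - h \<eta>'\<bar> \<le> r (Suc k)"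
    have k': "Suc k \<in> {1..N}" using k by simp
    have h0: "\<bar>h \<eta> - h \<eta>'\<bar> \<le> 0" if "\<eta> \<in> \<Lambda> (Suc k)" "\<eta>' \<in> \<Lambda> (Suc k)" "\<eta> \<noteq> \<eta>'" for \<eta> \<eta>'
      using h[OF that] r[OF k'] by linarith
    have "(\<Sum>\<eta>\<in>\<Lambda> (Suc k). w (Suc k) \<eta> * exp (s * (h \<eta> - (\<Sum>\<zeta>\<in>\<Lambda> (Suc k). w (Suc k) \<zeta> * h \<zeta>))))
        \<le> (\<Sum>\<eta>\<in>\<Lambda> (Suc k). w (Suc k) \<eta> * 1)"
    proof (intro sum_mono mult_left_mono weight_nonneg k')
      fix \<eta> assume "\<eta> \<in> \<Lambda> (Suc k)"
      then have "h \<eta> - (\<Sum>\<zeta>\<in>\<Lambda> (Suc k). w (Suc k) \<zeta> * h \<zeta>) \<le> 0"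
        using diff_mean_le[of "Suc k" h 0 \<eta>, OF k' h0] by simp
      then show "exp (s * (h \<eta> - (\<Sum>\<zeta>\<in>\<Lambda> (Suc k). w (Suc k) \<zeta> * h \<zeta>))) \<le> 1"
        using s by (simp add: mult_nonneg_nonpos)
    qed
    then show "(\<Sum>\<eta>\<in>\<Lambda> (Suc k). w (Suc k) \<eta> * exp (s * (h \<eta> - (\<Sum>\<zeta>\<in>\<Lambda> (Suc k). w (Suc k) \<zeta> * h \<zeta>)))) \<le> exp 0"
      using sum_weight[OF k'] by simp
  qed
  then show ?thesis by simp
qed

lemma bernstein_tail:
  assumes sb: "spread_bounded G f r" and vb: "variance_bounded r v"
    and C: "\<And>k. k \<in> {1..N} \<Longrightarrow> r k \<le> C" and V: "(\<Sum>k=1..N. v k) \<le> V" "0 \<le> V" and t: "0 \<le> t"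
  shows "tail G f t \<le> exp (- (t\<^sup>2 / (2 * V + 2 * C * t / 3)))"
proof -
  define D where "D = 2 * V + 2 * C * t / 3"
  \<comment> \<open>Bennett's bound needs positive \<open>C\<close> and \<open>V\<close>; the first
    three cases are the degenerate ones. In the first the claimed bound is at least 1, with
    \<open>D = 0\<close> read as division by zero.\<close>
  consider "t = 0 \<or> D \<le> 0" | "0 < t" "0 < D" "C \<le> 0" | "0 < t" "0 < C" "V = 0" | "0 < t" "0 < C" "0 < V"
    using t V by linarith
  then have "tail G f t \<le> exp (- (t\<^sup>2 / D))"
  proof cases
    case 1
    then have "1 \<le> exp (- (t\<^sup>2 / D))" by (auto simp: divide_nonneg_nonpos)
    then show ?thesis using tail_le_1[of f t G] by linarith
  next
    case 2
    \<comment> \<open>The rate \<open>t / D\<close> is chosen to reproduce the claimed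
      exponent.\<close>
    then have "tail G f t \<le> exp (- (t / D * t))"
      using C by (intro constant_tail[OF sb]) force+
    then show ?thesis by (simp add: power2_eq_square)
  next
    case 3
    \<comment> \<open>With \<open>V = 0\<close> the denominator \<open>D\<close> is
      \<open>2 * C * t / 3\<close>, so the target exponent is linear in \<open>t\<close> with this
      slope. The variance term contributes nothing positive.\<close>
    define s where "s = 3 / (2 * C)"
    define K where "K = (exp (s * C) - 1 - s * C) / C\<^sup>2"
    have K: "0 \<le> K" unfolding K_def
      using exp_ge_add_one_self[of "s * C"] by (intro divide_nonneg_nonneg; linarith?) auto
    have "tail G f t \<le> exp ((\<Sum>k=1..N. v k) * K - s * t)"
      unfolding K_def using 3 C by (intro bennett_exp_tail[OF sb vb]) (auto simp: s_def)
    also have "\<dots> \<le> exp (- (s * t))"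
      using mult_right_mono[OF V(1) K] 3 by simp
    also have "- (s * t) = - (t\<^sup>2 / D)"
      using 3 by (simp add: s_def D_def power2_eq_square field_simps)
    finally show ?thesis .
  next
    case 4
    have "tail G f t \<le> exp (- (V / C\<^sup>2 * phi (C * t / V)))"
      using 4 C V t by (intro bennett_tail[OF sb vb]) auto
    also have "\<dots> \<le> exp (- (t\<^sup>2 / D))"
    proof -
      have "V / C\<^sup>2 * ((C * t / V)\<^sup>2 / (2 + 2 * (C * t / V) / 3)) \<le> V / C\<^sup>2 * phi (C * t / V)"
        using 4 by (intro mult_left_mono phi_lower_bound) auto
      also have "V / C\<^sup>2 * ((C * t / V)\<^sup>2 / (2 + 2 * (C * t / V) / 3)) = t\<^sup>2 / D"
      proof -
        have "D = V * (2 + 2 * (C * t / V) / 3)" using 4 by (simp add: D_def field_simps)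
        then show ?thesis using 4 by (simp add: power_mult_distrib power_divide power2_eq_square)
      qed
      finally show ?thesis by simp
    qed
    finally show ?thesis .
  qed
  then show ?thesis by (simp add: D_def)
qed

text \<open>The variance of a two-point variable is the product of the two weights and the squared
  gap between its values.\<close>

lemma variance_bounded_two_points:
  assumes "zero \<noteq> one" "\<And>k. k \<in> {1..N} \<Longrightarrow> \<Lambda> k = {zero, one}"
  shows "variance_bounded r (\<lambda>k. (1 - w k one) * w k one * (r k)\<^sup>2)"
  unfolding variance_bounded_def
proof (intro ballI allI impI)
  fix k h assume k: "k \<in> {1..N}" and "\<forall>\<eta>\<in>\<Lambda> k. \<forall>\<eta>'\<in>\<Lambda> k. \<eta> \<noteq> \<eta>' \<longrightarrow> \<bar>h \<eta> - h \<eta>'\<bar> \<le> r k"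
  then have h: "\<bar>h one - h zero\<bar> \<le> r k" using assms k by auto
  have w0: "w k zero = 1 - w k one" using sum_weight[OF k] assms k by simp
  have w1: "0 \<le> w k one" "0 \<le> w k zero" using assms k by (auto intro: weight_nonneg)
  have "(\<Sum>\<eta>\<in>\<Lambda> k. w k \<eta> * (h \<eta> - (\<Sum>\<zeta>\<in>\<Lambda> k. w k \<zeta> * h \<zeta>))\<^sup>2)
      = (1 - w k one) * w k one * (h one - h zero)\<^sup>2"
    using assms k by (simp add: w0 power2_eq_square algebra_simps)
  also have "(h one - h zero)\<^sup>2 \<le> (r k)\<^sup>2"
    using h by (intro power2_le_iff_abs_le[THEN iffD2]) auto
  then have "(1 - w k one) * w k one * (h one - h zero)\<^sup>2 \<le> (1 - w k one) * w k one * (r k)\<^sup>2"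
    using w1 w0 by (intro mult_left_mono) auto
  finally show "(\<Sum>\<eta>\<in>\<Lambda> k. w k \<eta> * (h \<eta> - (\<Sum>\<zeta>\<in>\<Lambda> k. w k \<zeta> * h \<zeta>))\<^sup>2) \<le> (1 - w k one) * w k one * (r k)\<^sup>2" .
qed

text \<open>Centre at the heavy atom: it contributes nothing, and the remaining mass is at most
  \<open>p k\<close>. The bounds \<open>r\<close> and \<open>u\<close> are separate because (e)
  enlarges the range in the variance term but not in \<open>C\<close>.\<close>

lemma variance_bounded_atom:
  assumes "\<And>k. k \<in> {1..N} \<Longrightarrow> 0 \<le> p k \<and> (\<exists>\<eta>\<in>\<Lambda> k. 1 - p k \<le> w k \<eta>)"
    and "\<And>k. k \<in> {1..N} \<Longrightarrow> r k \<le> u k"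
  shows "variance_bounded r (\<lambda>k. p k * (u k)\<^sup>2)"
  unfolding variance_bounded_def
proof (intro ballI allI impI)
  fix k h assume k: "k \<in> {1..N}" and h: "\<forall>\<eta>\<in>\<Lambda> k. \<forall>\<eta>'\<in>\<Lambda> k. \<eta> \<noteq> \<eta>' \<longrightarrow> \<bar>h \<eta> - h \<eta>'\<bar> \<le> r k"
  obtain z where z: "z \<in> \<Lambda> k" "1 - p k \<le> w k z" using assms(1)[OF k] by blast
  have "(\<Sum>\<eta>\<in>\<Lambda> k. w k \<eta> * (h \<eta> - (\<Sum>\<zeta>\<in>\<Lambda> k. w k \<zeta> * h \<zeta>))\<^sup>2) \<le> (\<Sum>\<eta>\<in>\<Lambda> k. w k \<eta> * (h \<eta> - h z)\<^sup>2)"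
    by (rule variance_le_second_moment[OF sum_weight[OF k]])
  also have "\<dots> = (\<Sum>\<eta>\<in>\<Lambda> k - {z}. w k \<eta> * (h \<eta> - h z)\<^sup>2)"
    using z finite_factor[OF k] by (subst sum.remove[of _ z]) auto
  also have "\<dots> \<le> (\<Sum>\<eta>\<in>\<Lambda> k - {z}. w k \<eta> * (u k)\<^sup>2)"
  proof (intro sum_mono mult_left_mono)
    fix \<eta> assume \<eta>: "\<eta> \<in> \<Lambda> k - {z}"
    then have "\<bar>h \<eta> - h z\<bar> \<le> u k" using h z assms(2)[OF k] by force
    then show "(h \<eta> - h z)\<^sup>2 \<le> (u k)\<^sup>2" by (intro power2_le_iff_abs_le[THEN iffD2]) auto
    show "0 \<le> w k \<eta>" using \<eta> k by (auto intro: weight_nonneg)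
  qed
  also have "\<dots> = (1 - w k z) * (u k)\<^sup>2"
    using sum.remove[OF finite_factor[OF k] z(1), of "w k"] sum_weight[OF k]
    by (simp flip: sum_distrib_right)
  also have "\<dots> \<le> p k * (u k)\<^sup>2" using z by (intro mult_right_mono) auto
  finally show "(\<Sum>\<eta>\<in>\<Lambda> k. w k \<eta> * (h \<eta> - (\<Sum>\<zeta>\<in>\<Lambda> k. w k \<zeta> * h \<zeta>))\<^sup>2) \<le> p k * (u k)\<^sup>2" .
qed

subsection \<open>The exceptional event\<close>

definition atypical_prob :: "(nat \<Rightarrow> 'a) set \<Rightarrow> nat \<Rightarrow> (nat \<Rightarrow> 'a) \<Rightarrow> real" where
  "atypical_prob \<Gamma> k = cond k (\<lambda>x. of_bool (x \<notin> \<Gamma>))"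

text \<open>
  The threshold at time \<open>k\<close> is the one of the next coordinate, so that goodness at time \<open>k\<close> is
  known before the coordinate \<open>Suc k\<close> is revealed.
\<close>

definition good :: "(nat \<Rightarrow> 'a) set \<Rightarrow> (nat \<Rightarrow> real) \<Rightarrow> nat \<Rightarrow> (nat \<Rightarrow> 'a) \<Rightarrow> bool" where
  "good \<Gamma> \<gamma> k x \<longleftrightarrow> atypical_prob \<Gamma> k x \<le> \<gamma> (Suc k)"

definition exceptional :: "(nat \<Rightarrow> 'a) set \<Rightarrow> (nat \<Rightarrow> real) \<Rightarrow> (nat \<Rightarrow> 'a) set" where
  "exceptional \<Gamma> \<gamma> = {x \<in> points. x \<notin> \<Gamma> \<or> (\<exists>k<N. \<not> good \<Gamma> \<gamma> k x)}"

section \<open>Coupling and the spread outside the exceptional event\<close>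

lemma atypical_prob_nonneg: "k \<le> N \<Longrightarrow> x \<in> points \<Longrightarrow> 0 \<le> atypical_prob \<Gamma> k x"
  unfolding atypical_prob_def by (rule cond_nonneg) auto

text \<open>Backward induction from \<open>N\<close>. For full points this is the hypothesis on
  \<open>f\<close>: leaving \<open>\<Gamma>\<close> makes at least one of the two indicators 1,
  which pays for the extra \<open>d k - c k\<close>. Averaging both points over the same value of
  the next coordinate preserves the bound, as it is affine in the two probabilities.\<close>

lemma coupled_increment:
  assumes f: "typical_bounded_differences N \<Lambda> \<Gamma> f c d" and k: "k \<in> {1..N}" and "k \<le> j" "j \<le> N"
    and "x \<in> points" and \<eta>: "\<eta> \<in> \<Lambda> k" "\<eta>' \<in> \<Lambda> k" "\<eta> \<noteq> \<eta>'"
  shows "\<bar>cond j f (x(k := \<eta>)) - cond j f (x(k := \<eta>'))\<bar>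
    \<le> c k + (d k - c k) * (atypical_prob \<Gamma> j (x(k := \<eta>)) + atypical_prob \<Gamma> j (x(k := \<eta>')))"
  using assms(4,3,5)
proof (induction j arbitrary: x rule: inc_induct)
  case base
  define y y' where "y = x(k := \<eta>)" and "y' = x(k := \<eta>')"
  have "y \<in> points" "y' \<in> points"
    using base k \<eta> unfolding y_def y'_def by (auto intro!: points_upd)
  moreover have "differ_only_in N k y y'"
    using \<eta> by (auto simp: differ_only_in_def y_def y'_def)
  ultimately have "\<bar>f y - f y'\<bar> \<le> (if y \<in> \<Gamma> \<and> y' \<in> \<Gamma> then c k else d k)" "c k \<le> d k"
    using f k unfolding typical_bounded_differences_def by blast+
  then show ?case
    unfolding cond_N atypical_prob_def y_def[symmetric] y'_def[symmetric]
    by (auto split: if_splits)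
next
  case (step j)
  define u u' where "u \<zeta> = x(Suc j := \<zeta>, k := \<eta>)" and "u' \<zeta> = x(Suc j := \<zeta>, k := \<eta>')" for \<zeta>
  have j: "Suc j \<in> {1..N}" using step.hyps by simp
  \<comment> \<open>The updates at \<open>k\<close> and \<open>Suc j\<close> commute since
    \<open>k \<le> j\<close>; so each averaged pair again differs in coordinate \<open>k\<close>
    alone.\<close>
  have twist: "x(k := \<eta>, Suc j := \<zeta>) = u \<zeta>" "x(k := \<eta>', Suc j := \<zeta>) = u' \<zeta>" for \<zeta>
    using step.prems by (auto simp: u_def u'_def fun_upd_twist)
  let ?w = "w (Suc j)" and ?L = "\<Lambda> (Suc j)" and ?A = "atypical_prob \<Gamma> (Suc j)"
  have "\<bar>cond j f (x(k := \<eta>)) - cond j f (x(k := \<eta>'))\<bar>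
      = \<bar>\<Sum>\<zeta>\<in>?L. ?w \<zeta> * (cond (Suc j) f (u \<zeta>) - cond (Suc j) f (u' \<zeta>))\<bar>"
    using step.hyps by (simp add: cond_step twist right_diff_distrib sum_subtractf)
  also have "\<dots> \<le> (\<Sum>\<zeta>\<in>?L. ?w \<zeta> * \<bar>cond (Suc j) f (u \<zeta>) - cond (Suc j) f (u' \<zeta>)\<bar>)"
    using weight_nonneg[OF j] by (intro order.trans[OF sum_abs]) (simp add: abs_mult)
  also have "\<dots> \<le> (\<Sum>\<zeta>\<in>?L. ?w \<zeta> * (c k + (d k - c k) * (?A (u \<zeta>) + ?A (u' \<zeta>))))"
    using step.prems j unfolding u_def u'_def
    by (intro sum_mono mult_left_mono weight_nonneg step.IH points_upd) auto
  also have "\<dots> = (\<Sum>\<zeta>\<in>?L. ?w \<zeta>) * c k + (d k - c k) * ((\<Sum>\<zeta>\<in>?L. ?w \<zeta> * ?A (u \<zeta>)) + (\<Sum>\<zeta>\<in>?L. ?w \<zeta> * ?A (u' \<zeta>)))"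
    by (simp add: sum_distrib_left sum_distrib_right distrib_left sum.distrib mult_ac)
  also have "\<dots> = c k + (d k - c k) * (atypical_prob \<Gamma> j (x(k := \<eta>)) + atypical_prob \<Gamma> j (x(k := \<eta>')))"
    using step.hyps j by (simp add: atypical_prob_def cond_step[of j] twist sum_weight)
  finally show ?case .
qed

text \<open>The probability at time \<open>k\<close> is an average of nonnegative terms in which the
  value \<open>\<eta>\<close> has weight at least \<open>q\<close>.\<close>

lemma atypical_prob_upd_le:
  assumes k: "k < N" and x: "x \<in> points" "good \<Gamma> \<gamma> k x" and \<eta>: "\<eta> \<in> \<Lambda> (Suc k)" and q: "0 < q" "q \<le> w (Suc k) \<eta>"
  shows "atypical_prob \<Gamma> (Suc k) (x(Suc k := \<eta>)) \<le> \<gamma> (Suc k) * inverse q"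
proof -
  have k': "Suc k \<in> {1..N}" using k by simp
  have nn: "0 \<le> atypical_prob \<Gamma> (Suc k) (x(Suc k := \<zeta>))" if "\<zeta> \<in> \<Lambda> (Suc k)" for \<zeta>
    using k k' x that by (intro atypical_prob_nonneg points_upd) auto
  have "q * atypical_prob \<Gamma> (Suc k) (x(Suc k := \<eta>)) \<le> w (Suc k) \<eta> * atypical_prob \<Gamma> (Suc k) (x(Suc k := \<eta>))"
    using q nn[OF \<eta>] by (intro mult_right_mono)
  also have "\<dots> \<le> atypical_prob \<Gamma> k x"
    unfolding atypical_prob_def cond_step[OF k]
    using nn finite_factor[OF k'] weight_nonneg[OF k'] unfolding atypical_prob_def
    by (intro member_le_sum[OF \<eta>, of "\<lambda>\<zeta>. w (Suc k) \<zeta> * cond (Suc k) _ (x(Suc k := \<zeta>))"]) auto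
  also have "\<dots> \<le> \<gamma> (Suc k)" using x by (simp add: good_def)
  finally show ?thesis using q by (simp add: field_simps)
qed

lemma spread_bounded_good:
  assumes f: "typical_bounded_differences N \<Lambda> \<Gamma> f c d"
    and q: "\<And>k \<eta>. k \<in> {1..N} \<Longrightarrow> \<eta> \<in> \<Lambda> k \<Longrightarrow> 0 < q k \<and> q k \<le> w k \<eta>"
  shows "spread_bounded (good \<Gamma> \<gamma>) f (\<lambda>k. c k + 2 * \<gamma> k * (d k - c k) * inverse (q k))"
  unfolding spread_bounded_def
proof safe
  fix k x y assume k: "k < N" "x \<in> points" "y \<in> points" "\<forall>i\<in>{1..k}. x i = y i"
  then have "atypical_prob \<Gamma> k x = atypical_prob \<Gamma> k y"
    unfolding atypical_prob_def by (intro cond_cong) auto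
  then show "good \<Gamma> \<gamma> k x \<Longrightarrow> good \<Gamma> \<gamma> k y" "good \<Gamma> \<gamma> k y \<Longrightarrow> good \<Gamma> \<gamma> k x"
    by (simp_all add: good_def)
next
  fix k x \<eta> \<eta>' assume k: "k < N" and x: "x \<in> points" "good \<Gamma> \<gamma> k x"
    and \<eta>: "\<eta> \<in> \<Lambda> (Suc k)" "\<eta>' \<in> \<Lambda> (Suc k)" "\<eta> \<noteq> \<eta>'"
  let ?k = "Suc k"
  have k': "?k \<in> {1..N}" using k by simp
  have "\<bar>cond ?k f (x(?k := \<eta>)) - cond ?k f (x(?k := \<eta>'))\<bar>
      \<le> c ?k + (d ?k - c ?k) * (atypical_prob \<Gamma> ?k (x(?k := \<eta>)) + atypical_prob \<Gamma> ?k (x(?k := \<eta>')))"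
    using k x \<eta> by (intro coupled_increment[OF f k']) auto
  \<comment> \<open>Each of the two coupled points contributes
    \<open>\<gamma> ?k * inverse (q ?k)\<close>, whence the factor 2 in the spread.\<close>
  also have "\<dots> \<le> c ?k + (d ?k - c ?k) * (\<gamma> ?k * inverse (q ?k) + \<gamma> ?k * inverse (q ?k))"
    using f k' q[OF k'] \<eta> unfolding typical_bounded_differences_def
    by (intro add_left_mono mult_left_mono add_mono atypical_prob_upd_le[OF k x]) auto
  finally show "\<bar>cond ?k f (x(?k := \<eta>)) - cond ?k f (x(?k := \<eta>'))\<bar> \<le> c ?k + 2 * \<gamma> ?k * (d ?k - c ?k) * inverse (q ?k)"
    by (simp add: algebra_simps)
qed

text \<open>A union bound with Markov's inequality at each time would leave an extra summand for
  \<open>X \<notin> \<Gamma>\<close>. It is absorbed at time 0, where goodness is deterministic: if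
  it fails, the first summand on the right exceeds 1; if it holds, time 0 is never responsible, and
  the first summand pays for \<open>X \<notin> \<Gamma>\<close> because
  \<open>\<gamma> 1 \<le> 1\<close>.\<close>

lemma expect_exceptional_le:
  assumes N: "1 \<le> N" and \<gamma>: "\<And>k. k \<in> {1..N} \<Longrightarrow> 0 < \<gamma> k \<and> \<gamma> k \<le> 1"
  shows "expect (\<lambda>x. of_bool (x \<in> exceptional \<Gamma> \<gamma>)) \<le> (\<Sum>k=1..N. inverse (\<gamma> k) * expect (\<lambda>x. of_bool (x \<notin> \<Gamma>)))"
proof -
  define P where "P = expect (\<lambda>x. of_bool (x \<notin> \<Gamma>))"
  obtain x0 where x0: "x0 \<in> points" using points_nonempty by blast
  have P: "P = atypical_prob \<Gamma> 0 x" if "x \<in> points" for x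
    unfolding P_def atypical_prob_def cond_0[OF that] ..
  have P0: "0 \<le> P" using atypical_prob_nonneg[OF _ x0, of 0] P[OF x0] by simp
  have \<gamma>1: "0 < \<gamma> 1" "\<gamma> 1 \<le> 1" using \<gamma>[of 1] N by auto
  have rest: "0 \<le> (\<Sum>k=2..N. inverse (\<gamma> k) * P)"
    using \<gamma> P0 by (intro sum_nonneg mult_nonneg_nonneg) (auto intro!: less_imp_le)
  have split: "(\<Sum>k=1..N. inverse (\<gamma> k) * P) = inverse (\<gamma> 1) * P + (\<Sum>k=2..N. inverse (\<gamma> k) * P)"
    using N by (subst sum.atLeast_Suc_atMost) (auto simp: numeral_2_eq_2)
  show ?thesis
  proof (cases "P \<le> \<gamma> 1")
    case False
    have "expect (\<lambda>x. of_bool (x \<in> exceptional \<Gamma> \<gamma>)) \<le> expect (\<lambda>_. 1)"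
      by (intro expect_mono) auto
    also have "\<dots> \<le> inverse (\<gamma> 1) * P"
      using False \<gamma>1 by (simp add: expect_const field_simps)
    finally show ?thesis using rest split by (simp add: P_def)
  next
    case True
    \<comment> \<open>The index \<open>k\<close> is that of the threshold, so it belongs to goodness
      at time \<open>k - 1\<close>; the sum starts at 2 since time 0 is excluded.\<close>
    have "expect (\<lambda>x. of_bool (x \<in> exceptional \<Gamma> \<gamma>))
        \<le> expect (\<lambda>x. of_bool (x \<notin> \<Gamma>) + (\<Sum>k=2..N. inverse (\<gamma> k) * atypical_prob \<Gamma> (k - 1) x))"
    proof (rule expect_mono)
      fix x assume x: "x \<in> points"
      have nn: "0 \<le> inverse (\<gamma> k) * atypical_prob \<Gamma> (k - 1) x" if "k \<in> {2..N}" for k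
        using that x \<gamma>[of k] by (intro mult_nonneg_nonneg atypical_prob_nonneg) auto
      have nns: "0 \<le> (\<Sum>k=2..N. inverse (\<gamma> k) * atypical_prob \<Gamma> (k - 1) x)"
        by (intro sum_nonneg nn)
      consider "x \<notin> exceptional \<Gamma> \<gamma>" | "x \<notin> \<Gamma>" | k where "k < N" "\<not> good \<Gamma> \<gamma> k x"
        using x by (auto simp: exceptional_def)
      then show "of_bool (x \<in> exceptional \<Gamma> \<gamma>) \<le> of_bool (x \<notin> \<Gamma>) + (\<Sum>k=2..N. inverse (\<gamma> k) * atypical_prob \<Gamma> (k - 1) x)"
      proof cases
        case 3
        then have "k \<noteq> 0" using True P[OF x] by (intro notI) (simp add: good_def)
        then have k: "Suc k \<in> {2..N}" using 3 by auto
        have "1 \<le> inverse (\<gamma> (Suc k)) * atypical_prob \<Gamma> (Suc k - 1) x"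
          using 3 \<gamma>[of "Suc k"] by (simp add: good_def field_simps)
        also have "\<dots> \<le> (\<Sum>k=2..N. inverse (\<gamma> k) * atypical_prob \<Gamma> (k - 1) x)"
          using nn by (intro member_le_sum[OF k]) auto
        finally show ?thesis by simp
      qed (use nns in auto)
    qed
    also have "\<dots> = P + (\<Sum>k=2..N. inverse (\<gamma> k) * P)"
      unfolding expect_add expect_sum expect_mult atypical_prob_def
      by (auto simp: P_def expect_cond intro!: sum.cong)
    also have "\<dots> \<le> inverse (\<gamma> 1) * P + (\<Sum>k=2..N. inverse (\<gamma> k) * P)"
      using mult_right_mono[OF one_le_inverse[OF \<gamma>1] P0] by simp
    finally show ?thesis using split by (simp add: P_def)
  qed
qed

lemma exceptional_tail_le:
  "expect (\<lambda>x. of_bool (expect f + t \<le> f x \<and> x \<notin> exceptional \<Gamma> \<gamma>)) \<le> tail (good \<Gamma> \<gamma>) f t"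
  by (rule expect_mono) (auto simp: exceptional_def)

end

section \<open>Transfer to independent random variables\<close>

lemma sets_PiM_count_space_finite:
  assumes "finite I" "\<And>i. i \<in> I \<Longrightarrow> finite (\<Lambda> i)" "A \<subseteq> PiE I \<Lambda>"
  shows "A \<in> sets (PiM I (\<lambda>i. count_space (\<Lambda> i)))"
proof (rule sets.countable)
  show "countable A"
    using assms by (auto intro!: countable_finite finite_subset[OF assms(3)] finite_PiE)
  fix x assume "x \<in> A"
  then have x: "x \<in> PiE I \<Lambda>" using assms by auto
  then have "{x} = PiE I (\<lambda>i. {x i})" by (simp add: PiE_singleton PiE_iff)
  also have "\<dots> \<in> sets (PiM I (\<lambda>i. count_space (\<Lambda> i)))"
    using x assms by (intro sets_PiM_I_finite) auto
  finally show "{x} \<in> sets (PiM I (\<lambda>i. count_space (\<Lambda> i)))" .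
qed

context prob_space
begin

lemma rvec_in_PiE:
  assumes "indep_vars (\<lambda>k. count_space (\<Lambda> k)) X {1..N}" "\<omega> \<in> space M"
  shows "rvec N X \<omega> \<in> PiE {1..N} \<Lambda>"
proof -
  have "X k \<omega> \<in> \<Lambda> k" if "k \<in> {1..N}" for k
    using assms that by (auto simp: indep_vars_def dest!: bspec[OF _ that] measurable_space)
  then show ?thesis by (auto simp: rvec_def)
qed

lemma atom_in_events:
  assumes "Y \<in> measurable M (count_space A)" "\<eta> \<in> A"
  shows "{\<omega> \<in> space M. Y \<omega> = \<eta>} \<in> events"
  using measurable_sets[OF assms(1), of "{\<eta>}"] assms(2) by (simp add: vimage_def Int_def conj_commute)

lemma sum_atoms:
  assumes Y: "Y \<in> measurable M (count_space A)" and S: "finite S" "S \<subseteq> A"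
  shows "(\<Sum>\<eta>\<in>S. \<P>(\<omega> in M. Y \<omega> = \<eta>)) = \<P>(\<omega> in M. Y \<omega> \<in> S)"
proof -
  have "(\<Sum>\<eta>\<in>S. \<P>(\<omega> in M. Y \<omega> = \<eta>)) = prob (\<Union>\<eta>\<in>S. {\<omega> \<in> space M. Y \<omega> = \<eta>})"
    using S atom_in_events[OF Y]
    by (intro finite_measure_finite_Union[symmetric]) (auto simp: disjoint_family_on_def)
  also have "(\<Union>\<eta>\<in>S. {\<omega> \<in> space M. Y \<omega> = \<eta>}) = {\<omega> \<in> space M. Y \<omega> \<in> S}" by auto
  finally show ?thesis .
qed

text \<open>The events of distinct values are disjoint, so at most \<open>1 / a\<close> of them fit
  into total mass 1.\<close>

lemma finite_of_atoms_ge: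
  assumes Y: "Y \<in> measurable M (count_space A)" and a: "0 < a" "\<And>\<eta>. \<eta> \<in> A \<Longrightarrow> a \<le> \<P>(\<omega> in M. Y \<omega> = \<eta>)"
  shows "finite A"
proof -
  have "card S \<le> nat \<lfloor>1 / a\<rfloor>" if S: "S \<subseteq> A" "finite S" for S
  proof -
    have "real (card S) * a = (\<Sum>\<eta>\<in>S. a)" by simp
    also have "\<dots> \<le> (\<Sum>\<eta>\<in>S. \<P>(\<omega> in M. Y \<omega> = \<eta>))" using a(2) S by (intro sum_mono) auto
    also have "\<dots> \<le> 1" using S by (simp add: sum_atoms[OF Y])
    finally have "real (card S) \<le> 1 / a" using a(1) by (simp add: field_simps)
    then show ?thesis by (simp add: le_nat_floor)
  qed
  then show ?thesis by (metis finite_if_finite_subsets_card_bdd)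
qed

lemma weighted_product_atoms:
  assumes X: "indep_vars (\<lambda>k. count_space (\<Lambda> k)) X {1..N}"
    and fin: "\<And>k. k \<in> {1..N} \<Longrightarrow> finite (\<Lambda> k)"
    and pos: "\<And>k \<eta>. k \<in> {1..N} \<Longrightarrow> \<eta> \<in> \<Lambda> k \<Longrightarrow> 0 < \<P>(\<omega> in M. X k \<omega> = \<eta>)"
  shows "weighted_product N \<Lambda> (\<lambda>k \<eta>. \<P>(\<omega> in M. X k \<omega> = \<eta>))"
proof
  fix k assume k: "k \<in> {1..N}"
  then have meas: "X k \<in> measurable M (count_space (\<Lambda> k))"
    using X by (simp add: indep_vars_def)
  then show "(\<Sum>\<eta>\<in>\<Lambda> k. \<P>(\<omega> in M. X k \<omega> = \<eta>)) = 1"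
    using sum_atoms[OF meas fin[OF k] order.refl] measurable_space[OF meas]
    by (simp add: prob_space Collect_conj_eq Int_absorb2 subset_eq)
qed (use fin pos in auto)

lemma integral_rvec:
  assumes X: "indep_vars (\<lambda>k. count_space (\<Lambda> k)) X {1..N}" and N: "1 \<le> N"
    and wp: "weighted_product N \<Lambda> (\<lambda>k \<eta>. \<P>(\<omega> in M. X k \<omega> = \<eta>))"
  shows "(\<integral>\<omega>. F (rvec N X \<omega>) \<partial>M) = weighted_product.expect N \<Lambda> (\<lambda>k \<eta>. \<P>(\<omega> in M. X k \<omega> = \<eta>)) F"
proof -
  interpret W: weighted_product N \<Lambda> "\<lambda>k \<eta>. \<P>(\<omega> in M. X k \<omega> = \<eta>)" by (fact wp)
  \<comment> \<open>The event that the vector equals \<open>x\<close>, written as an intersection so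
    that independence factorises its probability.\<close>
  define E where "E x = (\<Inter>k\<in>{1..N}. X k -` {x k} \<inter> space M)" for x
  have E_iff: "\<omega> \<in> E x \<longleftrightarrow> rvec N X \<omega> = x" if "x \<in> PiE {1..N} \<Lambda>" "\<omega> \<in> space M" for x \<omega>
    using that N by (auto simp: E_def rvec_def fun_eq_iff PiE_iff extensional_def restrict_def)
  have E: "E x \<in> events" "prob (E x) = (\<Prod>k\<in>{1..N}. \<P>(\<omega> in M. X k \<omega> = x k))" if "x \<in> PiE {1..N} \<Lambda>" for x
  proof -
    have "X k -` {x k} \<inter> space M \<in> events" if "k \<in> {1..N}" for k
    proof (rule measurable_sets)
      show "X k \<in> measurable M (count_space (\<Lambda> k))" using X that by (simp add: indep_vars_def)
      show "{x k} \<in> sets (count_space (\<Lambda> k))" using \<open>x \<in> PiE {1..N} \<Lambda>\<close> that by auto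
    qed
    then show "E x \<in> events" unfolding E_def using N by (intro sets.finite_INT) auto
    have "prob (E x) = (\<Prod>k\<in>{1..N}. prob (X k -` {x k} \<inter> space M))"
      unfolding E_def using N that by (intro indep_varsD_finite[OF X]) auto
    then show "prob (E x) = (\<Prod>k\<in>{1..N}. \<P>(\<omega> in M. X k \<omega> = x k))"
      by (simp add: vimage_def Int_def conj_commute)
  qed
  have "(\<integral>\<omega>. F (rvec N X \<omega>) \<partial>M) = (\<integral>\<omega>. (\<Sum>x\<in>PiE {1..N} \<Lambda>. F x * indicator (E x) \<omega>) \<partial>M)"
  proof (rule Bochner_Integration.integral_cong[OF refl])
    fix \<omega> assume \<omega>: "\<omega> \<in> space M"
    have "(\<Sum>x\<in>PiE {1..N} \<Lambda>. F x * indicator (E x) \<omega>) = (\<Sum>x\<in>PiE {1..N} \<Lambda>. if rvec N X \<omega> = x then F x else 0)"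
      using \<omega> by (intro sum.cong refl) (auto simp: E_iff indicator_def)
    then show "F (rvec N X \<omega>) = (\<Sum>x\<in>PiE {1..N} \<Lambda>. F x * indicator (E x) \<omega>)"
      using W.finite_points rvec_in_PiE[OF X \<omega>] by simp
  qed
  also have "\<dots> = (\<Sum>x\<in>PiE {1..N} \<Lambda>. F x * prob (E x))"
    using E(1) sets.sets_into_space[OF E(1)]
    by (subst Bochner_Integration.integral_sum)
      (auto simp: emeasure_eq_measure Int_absorb2 intro!: sum.cong)
  also have "\<dots> = W.expect F"
    unfolding W.expect_def by (intro sum.cong refl) (simp add: E(2) mult.commute)
  finally show ?thesis .
qed

lemma prob_rvec:
  assumes X: "indep_vars (\<lambda>k. count_space (\<Lambda> k)) X {1..N}" and N: "1 \<le> N"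
    and wp: "weighted_product N \<Lambda> (\<lambda>k \<eta>. \<P>(\<omega> in M. X k \<omega> = \<eta>))"
  shows "\<P>(\<omega> in M. Q (rvec N X \<omega>)) =
    weighted_product.expect N \<Lambda> (\<lambda>k \<eta>. \<P>(\<omega> in M. X k \<omega> = \<eta>)) (\<lambda>x. of_bool (Q x))"
proof -
  have "\<P>(\<omega> in M. Q (rvec N X \<omega>)) = (\<integral>\<omega>. indicator {\<omega> \<in> space M. Q (rvec N X \<omega>)} \<omega> \<partial>M)"
    by (simp add: Int_absorb2)
  also have "\<dots> = (\<integral>\<omega>. of_bool (Q (rvec N X \<omega>)) \<partial>M)"
    by (intro Bochner_Integration.integral_cong) (auto simp: indicator_def)
  finally show ?thesis by (simp only: integral_rvec[OF assms, of "\<lambda>x. of_bool (Q x)"])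
qed

end

section \<open>Choice of the event and assembly of (a) to (e)\<close>

theorem theorem9:
  fixes M :: "'w measure" and N :: nat and \<Lambda> :: "nat \<Rightarrow> 'a set" and X :: "nat \<Rightarrow> 'w \<Rightarrow> 'a"
    and \<Gamma> :: "(nat \<Rightarrow> 'a) set" and \<gamma> :: "nat \<Rightarrow> real"
  assumes "prob_space M"
    and "1 \<le> N"
    and "prob_space.indep_vars M (\<lambda>k. count_space (\<Lambda> k)) X {1..N}"
    and "\<Gamma> \<in> sets (outcome_space N \<Lambda>)"
    and "\<And>k. k \<in> {1..N} \<Longrightarrow> 0 < \<gamma> k \<and> \<gamma> k \<le> 1"
  shows "\<exists>B \<in> sets (outcome_space N \<Lambda>).
    \<P>(\<omega> in M. rvec N X \<omega> \<in> B) \<le> (\<Sum>k=1..N. inverse (\<gamma> k) * \<P>(\<omega> in M. rvec N X \<omega> \<notin> \<Gamma>)) \<and>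
    PiE {1..N} \<Lambda> - B \<subseteq> \<Gamma> \<and>
    (\<forall>(f :: (nat \<Rightarrow> 'a) \<Rightarrow> real) (c :: nat \<Rightarrow> real) (d :: nat \<Rightarrow> real) (q :: nat \<Rightarrow> real) (t :: real).
      typical_bounded_differences N \<Lambda> \<Gamma> f c d \<longrightarrow>
      (\<forall>k\<in>{1..N}. 0 < q k \<and> q k \<le> (INF \<eta>\<in>\<Lambda> k. \<P>(\<omega> in M. X k \<omega> = \<eta>))) \<longrightarrow>
      0 \<le> t \<longrightarrow>
      (let \<mu> = (\<integral>\<omega>. f (rvec N X \<omega>) \<partial>M);
           e = (\<lambda>k. 2 * \<gamma> k * (d k - c k) * inverse (q k));
           C = (MAX k\<in>{1..N}. c k + e k);
           tail = \<P>(\<omega> in M. f (rvec N X \<omega>) \<ge> \<mu> + t \<and> rvec N X \<omega> \<notin> B)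
       in
        tail \<le> exp (- (t\<^sup>2 / (2 * (\<Sum>k=1..N. (c k + e k)\<^sup>2)))) \<and>
        ((\<forall>k\<in>{1..N}. card (\<Lambda> k) = 2) \<longrightarrow>
          tail \<le> exp (4 * (- (t\<^sup>2 / (2 * (\<Sum>k=1..N. (c k + e k)\<^sup>2)))))) \<and>
        (\<forall>zero one. zero \<noteq> one \<longrightarrow> (\<forall>k\<in>{1..N}. \<Lambda> k = {zero, one}) \<longrightarrow>
          (let p = (\<lambda>k. \<P>(\<omega> in M. X k \<omega> = one));
               V = (\<Sum>k=1..N. (1 - p k) * p k * (c k + e k)\<^sup>2)
           in
            tail \<le> exp (- (t\<^sup>2 / (2 * V + 2 * C * t / 3))) \<and>
            (0 < V \<longrightarrow> 0 < C \<longrightarrow> tail \<le> exp (- (V / C\<^sup>2 * phi (C * t / V)))))) \<and>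
        (\<forall>p :: nat \<Rightarrow> real.
          (\<forall>k\<in>{1..N}. 0 \<le> p k \<and> p k < 1 \<and>
            (SUP \<eta>\<in>\<Lambda> k. \<P>(\<omega> in M. X k \<omega> = \<eta>)) \<ge> 1 - p k) \<longrightarrow>
          tail \<le> exp (- (t\<^sup>2 / (2 * (\<Sum>k=1..N. p k * (c k + e k * inverse (1 - p k))\<^sup>2)
                               + 2 * C * t / 3))))))"
proof -
  interpret prob_space M by (fact assms(1))
  note N = assms(2) and X = assms(3) and \<gamma> = assms(5)
  define w where "w k \<eta> = \<P>(\<omega> in M. X k \<omega> = \<eta>)" for k \<eta>
  define regular where "regular \<longleftrightarrow> (\<forall>k\<in>{1..N}. finite (\<Lambda> k) \<and> (\<forall>\<eta>\<in>\<Lambda> k. 0 < w k \<eta>))"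
  have atoms: "finite (\<Lambda> k) \<and> (\<forall>\<eta>\<in>\<Lambda> k. a \<le> w k \<eta>)"
    if k: "k \<in> {1..N}" and a: "0 < a" "a \<le> (INF \<eta>\<in>\<Lambda> k. w k \<eta>)" for k a
  proof -
    have le: "a \<le> w k \<eta>" if "\<eta> \<in> \<Lambda> k" for \<eta>
    proof -
      \<comment> \<open>A real infimum bounds the values from below only for sets that are bounded
        below; probabilities are.\<close>
      have "bdd_below (w k ` \<Lambda> k)" by (intro bdd_belowI[of _ 0]) (auto simp: w_def)
      then show ?thesis using a cINF_lower[of "w k" "\<Lambda> k" \<eta>] that by linarith
    qed
    moreover have "finite (\<Lambda> k)"
    proof (rule finite_of_atoms_ge[OF _ a(1)])
      show "X k \<in> measurable M (count_space (\<Lambda> k))" using X k by (simp add: indep_vars_def)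
    qed (use le in \<open>simp add: w_def\<close>)
    ultimately show ?thesis by blast
  qed
  \<comment> \<open>\<open>B\<close> has to be chosen before \<open>q\<close>. If \<open>regular\<close> fails, no \<open>q\<close> is admissible and only the
    first two properties of \<open>B\<close> remain to be ensured.\<close>
  show ?thesis
  proof (cases regular)
    case False
    \<comment> \<open>The complement of \<open>\<Gamma>\<close> suffices: the first summand alone
      dominates its probability, since \<open>inverse (\<gamma> 1)\<close> is at least 1.\<close>
    define B where "B = space (outcome_space N \<Lambda>) - \<Gamma>"
    have space: "space (outcome_space N \<Lambda>) = PiE {1..N} \<Lambda>"
      by (simp add: outcome_space_def space_PiM)
    have vacuous: "\<not> (\<forall>k\<in>{1..N}. 0 < q k \<and> q k \<le> (INF \<eta>\<in>\<Lambda> k. \<P>(\<omega> in M. X k \<omega> = \<eta>)))" for q :: "nat \<Rightarrow> real"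
    proof
      assume "\<forall>k\<in>{1..N}. 0 < q k \<and> q k \<le> (INF \<eta>\<in>\<Lambda> k. \<P>(\<omega> in M. X k \<omega> = \<eta>))"
      then have "finite (\<Lambda> k) \<and> (\<forall>\<eta>\<in>\<Lambda> k. 0 < w k \<eta>)" if "k \<in> {1..N}" for k
        using atoms[OF that, of "q k"] that unfolding w_def by (meson less_le_trans)
      with False show False unfolding regular_def by blast
    qed
    have "\<P>(\<omega> in M. rvec N X \<omega> \<in> B) = \<P>(\<omega> in M. rvec N X \<omega> \<notin> \<Gamma>)"
      using rvec_in_PiE[OF X] by (auto simp: B_def space intro!: arg_cong[of _ _ prob])
    also have "\<dots> \<le> inverse (\<gamma> 1) * \<P>(\<omega> in M. rvec N X \<omega> \<notin> \<Gamma>)"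
      using \<gamma>[of 1] N mult_right_mono[of 1 "inverse (\<gamma> 1)" "\<P>(\<omega> in M. rvec N X \<omega> \<notin> \<Gamma>)"]
      by (simp add: one_le_inverse)
    also have "\<dots> \<le> (\<Sum>k=1..N. inverse (\<gamma> k) * \<P>(\<omega> in M. rvec N X \<omega> \<notin> \<Gamma>))"
    proof (rule member_le_sum[of 1 "{1..N}" "\<lambda>k. inverse (\<gamma> k) * \<P>(\<omega> in M. rvec N X \<omega> \<notin> \<Gamma>)"])
      fix k assume "k \<in> {1..N} - {1}"
      then show "0 \<le> inverse (\<gamma> k) * \<P>(\<omega> in M. rvec N X \<omega> \<notin> \<Gamma>)"
        using \<gamma>[of k] by (intro mult_nonneg_nonneg) auto
    qed (use N in auto)
    finally have "\<P>(\<omega> in M. rvec N X \<omega> \<in> B) \<le> (\<Sum>k=1..N. inverse (\<gamma> k) * \<P>(\<omega> in M. rvec N X \<omega> \<notin> \<Gamma>))" .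
    moreover have "B \<in> sets (outcome_space N \<Lambda>)" "PiE {1..N} \<Lambda> - B \<subseteq> \<Gamma>"
      using assms(4) unfolding B_def space[symmetric] by auto
    ultimately show ?thesis
    proof (intro bexI[of _ B] conjI allI impI, goal_cases)
      case (3 f c d q t)
      with vacuous[of q] show ?case by simp
    qed
  next
    case True
    have wp: "weighted_product N \<Lambda> (\<lambda>k \<eta>. \<P>(\<omega> in M. X k \<omega> = \<eta>))"
      using True by (intro weighted_product_atoms X) (auto simp: regular_def w_def)
    then interpret W: weighted_product N \<Lambda> w
      unfolding w_def .
    note prob_expect = prob_rvec[OF X N wp, folded w_def] and integral_expect = integral_rvec[OF X N wp, folded w_def]
    define B where "B = W.exceptional \<Gamma> \<gamma>"
    have B: "B \<in> sets (outcome_space N \<Lambda>)"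
      unfolding outcome_space_def B_def W.exceptional_def
      by (intro sets_PiM_count_space_finite) (use W.finite_factor in auto)
    have PB: "\<P>(\<omega> in M. rvec N X \<omega> \<in> B) \<le> (\<Sum>k=1..N. inverse (\<gamma> k) * \<P>(\<omega> in M. rvec N X \<omega> \<notin> \<Gamma>))"
      unfolding prob_expect[of "\<lambda>x. x \<in> W.exceptional \<Gamma> \<gamma>"] prob_expect[of "\<lambda>x. x \<notin> \<Gamma>"] B_def
      by (rule W.expect_exceptional_le[OF N \<gamma>])
    have sub: "PiE {1..N} \<Lambda> - B \<subseteq> \<Gamma>"
      by (auto simp: B_def W.exceptional_def)
    show ?thesis
    proof (intro bexI[OF _ B] conjI PB sub allI impI, goal_cases)
      case (1 f c d q t)
      note f = 1(1) and q = 1(2) and t = 1(3)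
      define e where "e = (\<lambda>k. 2 * \<gamma> k * (d k - c k) * inverse (q k))"
      define C where "C = (MAX k\<in>{1..N}. c k + e k)"
      define P where "P = \<P>(\<omega> in M. f (rvec N X \<omega>) \<ge> (\<integral>\<omega>. f (rvec N X \<omega>) \<partial>M) + t \<and> rvec N X \<omega> \<notin> B)"
      have q': "0 < q k \<and> q k \<le> w k \<eta>" if "k \<in> {1..N}" "\<eta> \<in> \<Lambda> k" for k \<eta>
        using q atoms[OF that(1), of "q k"] that unfolding w_def by blast
      have sb: "W.spread_bounded (W.good \<Gamma> \<gamma>) f (\<lambda>k. c k + e k)"
        unfolding e_def by (rule W.spread_bounded_good[OF f q'])
      have P: "P \<le> W.tail (W.good \<Gamma> \<gamma>) f t"
        unfolding P_def integral_expect[of f] B_def prob_expect[of "\<lambda>x. W.expect f + t \<le> f x \<and> x \<notin> W.exceptional \<Gamma> \<gamma>"]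
        by (rule W.exceptional_tail_le)
      have C: "c k + e k \<le> C" if "k \<in> {1..N}" for k
        using that unfolding C_def by (intro Max_ge) auto
      \<comment> \<open>Hoeffding's bound for ranges of length \<open>c k + e k\<close> carries the
        factor 4 of (b); (a) follows by dropping it, the exponent being nonpositive.\<close>
      have b: "P \<le> exp (4 * - (t\<^sup>2 / (2 * (\<Sum>k=1..N. (c k + e k)\<^sup>2))))"
        using P W.hoeffding_tail[OF sb t] by linarith
      have "0 \<le> t\<^sup>2 / (2 * (\<Sum>k=1..N. (c k + e k)\<^sup>2))"
        by (intro divide_nonneg_nonneg mult_nonneg_nonneg sum_nonneg) auto
      then have "exp (4 * - (t\<^sup>2 / (2 * (\<Sum>k=1..N. (c k + e k)\<^sup>2)))) \<le> exp (- (t\<^sup>2 / (2 * (\<Sum>k=1..N. (c k + e k)\<^sup>2))))"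
        by simp
      with b have a: "P \<le> exp (- (t\<^sup>2 / (2 * (\<Sum>k=1..N. (c k + e k)\<^sup>2))))" by linarith
      have cd: "P \<le> exp (- (t\<^sup>2 / (2 * V + 2 * C * t / 3))) \<and>
          (0 < V \<longrightarrow> 0 < C \<longrightarrow> P \<le> exp (- (V / C\<^sup>2 * phi (C * t / V))))"
        if "zero \<noteq> one" "\<forall>k\<in>{1..N}. \<Lambda> k = {zero, one}"
          and V_def: "V = (\<Sum>k=1..N. (1 - w k one) * w k one * (c k + e k)\<^sup>2)" for zero one V
      proof (intro conjI impI)
        from that(1,2) have vb: "W.variance_bounded (\<lambda>k. c k + e k) (\<lambda>k. (1 - w k one) * w k one * (c k + e k)\<^sup>2)"
          by (intro W.variance_bounded_two_points) auto
        have "w k one \<le> 1" "0 \<le> w k one" for k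
          by (auto simp: w_def)
        then have "0 \<le> V" unfolding V_def by (intro sum_nonneg mult_nonneg_nonneg) auto
        then have "W.tail (W.good \<Gamma> \<gamma>) f t \<le> exp (- (t\<^sup>2 / (2 * V + 2 * C * t / 3)))"
          using W.bernstein_tail[OF sb vb C _ _ t, of V] unfolding V_def by simp
        with P show "P \<le> exp (- (t\<^sup>2 / (2 * V + 2 * C * t / 3)))" by linarith
        assume "0 < V" "0 < C"
        then have "W.tail (W.good \<Gamma> \<gamma>) f t \<le> exp (- (V / C\<^sup>2 * phi (C * t / V)))"
          using W.bennett_tail[OF sb vb C _ _ _ t, of V] unfolding V_def by simp
        with P show "P \<le> exp (- (V / C\<^sup>2 * phi (C * t / V)))" by linarith
      qed
      have e: "P \<le> exp (- (t\<^sup>2 / (2 * (\<Sum>k=1..N. p k * (c k + e k * inverse (1 - p k))\<^sup>2) + 2 * C * t / 3)))"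
        if p: "\<forall>k\<in>{1..N}. 0 \<le> p k \<and> p k < 1 \<and> 1 - p k \<le> (SUP \<eta>\<in>\<Lambda> k. \<P>(\<omega> in M. X k \<omega> = \<eta>))" for p
      proof -
        have vb: "W.variance_bounded (\<lambda>k. c k + e k) (\<lambda>k. p k * (c k + e k * inverse (1 - p k))\<^sup>2)"
        proof (rule W.variance_bounded_atom, intro conjI)
          fix k assume k: "k \<in> {1..N}"
          then show "0 \<le> p k" using p by blast
          have "\<Lambda> k \<noteq> {}" using W.sum_weight[OF k] by auto
          \<comment> \<open>The supremum over a finite nonempty set is attained, which supplies the
            heavy atom.\<close>
          then have "Sup (w k ` \<Lambda> k) \<in> w k ` \<Lambda> k"
            using W.finite_factor[OF k] by (simp add: cSup_eq_Max)
          then obtain \<eta> where \<eta>: "\<eta> \<in> \<Lambda> k" "w k \<eta> = (SUP \<eta>\<in>\<Lambda> k. w k \<eta>)" by auto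
          have "1 - p k \<le> w k \<eta>" unfolding \<eta>(2) using p k by (simp add: w_def)
          with \<eta>(1) show "\<exists>\<eta>\<in>\<Lambda> k. 1 - p k \<le> w k \<eta>" by blast
          \<comment> \<open>Together with \<open>p k < 1\<close> this shows that dividing
            \<open>e k\<close> by \<open>1 - p k\<close> only enlarges the range.\<close>
          have "0 \<le> e k"
            using f \<gamma>[OF k] q'[OF k \<eta>(1)] k by (auto simp: e_def typical_bounded_differences_def)
          moreover have "1 \<le> inverse (1 - p k)" using p k by (intro one_le_inverse) auto
          ultimately show "c k + e k \<le> c k + e k * inverse (1 - p k)"
            by (simp add: mult_left_le_one_le mult_le_cancel_left1)
        qed
        have "0 \<le> (\<Sum>k=1..N. p k * (c k + e k * inverse (1 - p k))\<^sup>2)"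
          using p by (intro sum_nonneg mult_nonneg_nonneg) auto
        with P W.bernstein_tail[OF sb vb C order.refl _ t]
        show "P \<le> exp (- (t\<^sup>2 / (2 * (\<Sum>k=1..N. p k * (c k + e k * inverse (1 - p k))\<^sup>2) + 2 * C * t / 3)))"
          by linarith
      qed
      have "P \<le> exp (- (t\<^sup>2 / (2 * (\<Sum>k=1..N. (c k + e k)\<^sup>2)))) \<and>
        ((\<forall>k\<in>{1..N}. card (\<Lambda> k) = 2) \<longrightarrow> P \<le> exp (4 * (- (t\<^sup>2 / (2 * (\<Sum>k=1..N. (c k + e k)\<^sup>2)))))) \<and>
        (\<forall>zero one. zero \<noteq> one \<longrightarrow> (\<forall>k\<in>{1..N}. \<Lambda> k = {zero, one}) \<longrightarrow>
          (let V = (\<Sum>k=1..N. (1 - w k one) * w k one * (c k + e k)\<^sup>2) in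
            P \<le> exp (- (t\<^sup>2 / (2 * V + 2 * C * t / 3))) \<and>
            (0 < V \<longrightarrow> 0 < C \<longrightarrow> P \<le> exp (- (V / C\<^sup>2 * phi (C * t / V)))))) \<and>
        (\<forall>p. (\<forall>k\<in>{1..N}. 0 \<le> p k \<and> p k < 1 \<and> 1 - p k \<le> (SUP \<eta>\<in>\<Lambda> k. \<P>(\<omega> in M. X k \<omega> = \<eta>))) \<longrightarrow>
          P \<le> exp (- (t\<^sup>2 / (2 * (\<Sum>k=1..N. p k * (c k + e k * inverse (1 - p k))\<^sup>2) + 2 * C * t / 3))))"
        unfolding Let_def by (intro conjI allI impI a b e cd[THEN conjunct1] cd[THEN conjunct2, rule_format]) (assumption | rule refl | erule bspec, assumption)+
      then show ?case
        unfolding Let_def P_def C_def e_def w_def .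
    qed
  qed
qed

end
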